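(* Let $k$ be a field of positive characteristic. There exist two non-isomorphic binomial bimonoids in $(\mathsf{Vec}_k,\otimes,k)$ whose underlying graded $k$-vector spaces are isomorphic (i.e. isomorphic in $\mathsf{Vec}_k^{\mathbb{N}}$).
   Context: $(\mathsf{Vec}_k,\otimes,k)$ is the symmetric monoidal category of $k$-vector spaces with the usual tensor product; coherence isomorphisms are suppressed. $f;g$ denotes composition in diagrammatic order (first $f$, then $g$); $\otimes$ binds tighter than $;$. $\gamma_{A,B}:A\otimes B\to B\otimes A$ is the symmetry. A graded $k$-vector space is a family $(A_n)_{n\ge 0}\in\mathsf{Vec}_k^{\mathbb{N}}$; morphisms are arbitrary families of $k$-linear maps $(f_n:A_n\to B_n)_{n\ge 0}$. A binomial bimonoid (with $I=k$ here) is a graded object $(A_n)_{n\ge 0}$ with maps $\nabla_{n,p}:A_n\otimes A_p\to A_{n+p}$, $\Delta_{n,p}:A_{n+p}\to A_n\otimes A_p$, $\eta:I\to A_0$, $\epsilon:A_0\to I$ such that for all $n,p,q,r\ge 0$: (i) $\eta\otimes\mathsf{id}_{A_n};\nabla_{0,n}=\mathsf{id}_{A_n}$; (ii) $\nabla_{n,p}\otimes\mathsf{id}_{A_q};\nabla_{n+p,q}=\mathsf{id}_{A_n}\otimes\nabla_{p,q};\nabla_{n,p+q}$; (iii) $\gamma_{A_n,A_p};\nabla_{p,n}=\nabla_{n,p}$; (iv) $\Delta_{0,n};\epsilon\otimes\mathsf{id}_{A_n}=\mathsf{id}_{A_n}$; (v) $\Delta_{n+p,q};\Delta_{n,p}\otimes\mathsf{id}_{A_q}=\Delta_{n,p+q};\mathsf{id}_{A_n}\otimes\Delta_{p,q}$;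 (vi) $\Delta_{n,p};\gamma_{A_n,A_p}=\Delta_{p,n}$; (vii) $\nabla_{0,0};\epsilon=\epsilon\otimes\epsilon$; (viii) $\eta;\Delta_{0,0}=\eta\otimes\eta$; (ix) $\eta;\epsilon=\mathsf{id}_I$; (x) whenever $n+p=q+r$, $\nabla_{n,p};\Delta_{q,r}=\sum\Delta_{a,b}\otimes\Delta_{c,d};\mathsf{id}_{A_a}\otimes\gamma_{A_b,A_c}\otimes\mathsf{id}_{A_d};\nabla_{a,c}\otimes\nabla_{b,d}$, sum over $a,b,c,d\ge 0$ with $a+b=n$, $c+d=p$, $a+c=q$, $b+d=r$; (xi) $\epsilon;\eta=\mathsf{id}_{A_0}$; (xii) $\Delta_{n,p};\nabla_{n,p}=\binom{n+p}{n}\mathsf{id}_{A_{n+p}}$. A morphism of binomial bimonoids $(A_n)\to(B_n)$ is a family $(f_n:A_n\to B_n)_{n\ge 0}$ with $\eta;f_0=\eta$, $f_0;\epsilon=\epsilon$, $f_n\otimes f_p;\nabla_{n,p}=\nabla_{n,p};f_{n+p}$ and $\Delta_{n,p};f_n\otimes f_p=f_{n+p};\Delta_{n,p}$ for all $n,p\ge 0$; isomorphism of binomial bimonoids means isomorphism in the resulting category (with componentwise composition). *)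

theory Defs
  imports "HOL-Algebra.AbelCoset" "Jordan_Normal_Form.Missing_VectorSpace"
begin

definition ring_characteristic :: "('a, 'm) ring_scheme \<Rightarrow> nat" where
  "ring_characteristic K =
    (if \<exists>n::nat. 0 < n \<and> [n] \<cdot>\<^bsub>K\<^esub> \<one>\<^bsub>K\<^esub> = \<zero>\<^bsub>K\<^esub>
     then LEAST n::nat. 0 < n \<and> [n] \<cdot>\<^bsub>K\<^esub> \<one>\<^bsub>K\<^esub> = \<zero>\<^bsub>K\<^esub> else 0)"

section \<open>The tensor product of vector spaces\<close>

text \<open>Linear maps are functions in \<^const>\<open>module_hom\<close>; their values outside the carrier are
  irrelevant, so equality of linear maps always means equality on the carrier of the source.
  Vector spaces are \<^typ>\<open>('a, 'v) module\<close> records; the ring fields \<^const>\<open>mult\<close> and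
  \<^const>\<open>one\<close> that these records inherit play no role.\<close>

context field
begin

definition free_space :: "'s set \<Rightarrow> ('a, 's \<Rightarrow> 'a) module" where
  "free_space S = (func_space S)
     \<lparr>carrier := {\<phi> \<in> carrier (func_space S). finite {s \<in> S. \<phi> s \<noteq> \<zero>}}\<rparr>"

definition free_basis :: "'s set \<Rightarrow> 's \<Rightarrow> 's \<Rightarrow> 'a" where
  "free_basis S s = (\<lambda>t\<in>S. if t = s then \<one> else \<zero>)"

definition bilinear_relations ::
  "('a, 'v) module \<Rightarrow> ('a, 'w) module \<Rightarrow> ('v \<times> 'w \<Rightarrow> 'a) set" where
  "bilinear_relations V W =
    (let F = free_space (carrier V \<times> carrier W);
         \<delta> = (\<lambda>x y. free_basis (carrier V \<times> carrier W) (x, y))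
     in {\<delta> (x \<oplus>\<^bsub>V\<^esub> x') y \<ominus>\<^bsub>F\<^esub> (\<delta> x y \<oplus>\<^bsub>F\<^esub> \<delta> x' y) | x x' y.
           x \<in> carrier V \<and> x' \<in> carrier V \<and> y \<in> carrier W} \<union>
        {\<delta> x (y \<oplus>\<^bsub>W\<^esub> y') \<ominus>\<^bsub>F\<^esub> (\<delta> x y \<oplus>\<^bsub>F\<^esub> \<delta> x y') | x y y'.
           x \<in> carrier V \<and> y \<in> carrier W \<and> y' \<in> carrier W} \<union>
        {\<delta> (c \<odot>\<^bsub>V\<^esub> x) y \<ominus>\<^bsub>F\<^esub> (c \<odot>\<^bsub>F\<^esub> \<delta> x y) | c x y.
           c \<in> carrier R \<and> x \<in> carrier V \<and> y \<in> carrier W} \<union>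
        {\<delta> x (c \<odot>\<^bsub>W\<^esub> y) \<ominus>\<^bsub>F\<^esub> (c \<odot>\<^bsub>F\<^esub> \<delta> x y) | c x y.
           c \<in> carrier R \<and> x \<in> carrier V \<and> y \<in> carrier W})"

definition bilinear_span ::
  "('a, 'v) module \<Rightarrow> ('a, 'w) module \<Rightarrow> ('v \<times> 'w \<Rightarrow> 'a) set" where
  "bilinear_span V W =
    module.span R (free_space (carrier V \<times> carrier W)) (bilinear_relations V W)"

definition tensor :: "('a, 'v) module \<Rightarrow> ('a, 'w) module \<Rightarrow> ('a, ('v \<times> 'w \<Rightarrow> 'a) set) module"
    (infixl \<open>\<otimes>\<^sub>V\<close> 70) where
  "V \<otimes>\<^sub>V W =
    (let F = free_space (carrier V \<times> carrier W); N = bilinear_span V W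
     in \<lparr>carrier = a_rcosets\<^bsub>F\<^esub> N, mult = undefined, one = undefined,
         zero = N, add = set_add F,
         smult = (\<lambda>c X. \<Union>\<phi>\<in>X. N +>\<^bsub>F\<^esub> (c \<odot>\<^bsub>F\<^esub> \<phi>))\<rparr>)"

definition pure_tensor ::
  "('a, 'v) module \<Rightarrow> ('a, 'w) module \<Rightarrow> 'v \<Rightarrow> 'w \<Rightarrow> ('v \<times> 'w \<Rightarrow> 'a) set" where
  "pure_tensor V W x y = bilinear_span V W +>\<^bsub>free_space (carrier V \<times> carrier W)\<^esub>
     free_basis (carrier V \<times> carrier W) (x, y)"

text \<open>For bilinear \<open>\<beta>\<close>, the linear extension of \<open>\<beta>\<close> to the free space is constant on each coset,
  so \<open>tensor_lift V W U \<beta>\<close> is the linear map with \<open>pure_tensor V W x y \<mapsto> \<beta> x y\<close>.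
  It is only ever used for bilinear \<open>\<beta>\<close>.\<close>

definition tensor_lift ::
  "('a, 'v) module \<Rightarrow> ('a, 'w) module \<Rightarrow> ('a, 'u) module \<Rightarrow> ('v \<Rightarrow> 'w \<Rightarrow> 'u)
    \<Rightarrow> ('v \<times> 'w \<Rightarrow> 'a) set \<Rightarrow> 'u" where
  "tensor_lift V W U \<beta> X =
    the_elem ((\<lambda>\<phi>. \<Oplus>\<^bsub>U\<^esub>s\<in>{s \<in> carrier V \<times> carrier W. \<phi> s \<noteq> \<zero>}.
                  \<phi> s \<odot>\<^bsub>U\<^esub> \<beta> (fst s) (snd s)) ` X)"

definition tensor_map ::
  "('a, 'v) module \<Rightarrow> ('a, 'w) module \<Rightarrow> ('a, 'v') module \<Rightarrow> ('a, 'w') module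
    \<Rightarrow> ('v \<Rightarrow> 'v') \<Rightarrow> ('w \<Rightarrow> 'w') \<Rightarrow> ('v \<times> 'w \<Rightarrow> 'a) set \<Rightarrow> ('v' \<times> 'w' \<Rightarrow> 'a) set" where
  "tensor_map V W V' W' f g =
    tensor_lift V W (V' \<otimes>\<^sub>V W') (\<lambda>x y. pure_tensor V' W' (f x) (g y))"

section \<open>The symmetric monoidal structure\<close>

definition unit_space :: "('a, 'a) module" where
  "unit_space = \<lparr>carrier = carrier R, mult = (\<otimes>), one = \<one>, zero = \<zero>, add = (\<oplus>), smult = (\<otimes>)\<rparr>"

definition left_unitor :: "('a, 'v) module \<Rightarrow> ('a \<times> 'v \<Rightarrow> 'a) set \<Rightarrow> 'v" where
  "left_unitor V = tensor_lift unit_space V V (\<lambda>c x. c \<odot>\<^bsub>V\<^esub> x)"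

definition left_unitor_inv :: "('a, 'v) module \<Rightarrow> 'v \<Rightarrow> ('a \<times> 'v \<Rightarrow> 'a) set" where
  "left_unitor_inv V x = pure_tensor unit_space V \<one> x"

definition symmetry ::
  "('a, 'v) module \<Rightarrow> ('a, 'w) module \<Rightarrow> ('v \<times> 'w \<Rightarrow> 'a) set \<Rightarrow> ('w \<times> 'v \<Rightarrow> 'a) set" where
  "symmetry V W = tensor_lift V W (W \<otimes>\<^sub>V V) (\<lambda>x y. pure_tensor W V y x)"

definition associator ::
  "('a, 'u) module \<Rightarrow> ('a, 'v) module \<Rightarrow> ('a, 'w) module
    \<Rightarrow> (('u \<times> 'v \<Rightarrow> 'a) set \<times> 'w \<Rightarrow> 'a) set \<Rightarrow> ('u \<times> ('v \<times> 'w \<Rightarrow> 'a) set \<Rightarrow> 'a) set" where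
  "associator U V W = tensor_lift (U \<otimes>\<^sub>V V) W (U \<otimes>\<^sub>V (V \<otimes>\<^sub>V W))
     (\<lambda>t z. tensor_lift U V (U \<otimes>\<^sub>V (V \<otimes>\<^sub>V W))
        (\<lambda>x y. pure_tensor U (V \<otimes>\<^sub>V W) x (pure_tensor V W y z)) t)"

definition associator_inv ::
  "('a, 'u) module \<Rightarrow> ('a, 'v) module \<Rightarrow> ('a, 'w) module
    \<Rightarrow> ('u \<times> ('v \<times> 'w \<Rightarrow> 'a) set \<Rightarrow> 'a) set \<Rightarrow> (('u \<times> 'v \<Rightarrow> 'a) set \<times> 'w \<Rightarrow> 'a) set" where
  "associator_inv U V W = tensor_lift U (V \<otimes>\<^sub>V W) (U \<otimes>\<^sub>V V \<otimes>\<^sub>V W)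
     (\<lambda>x t. tensor_lift V W (U \<otimes>\<^sub>V V \<otimes>\<^sub>V W)
        (\<lambda>y z. pure_tensor (U \<otimes>\<^sub>V V) W (pure_tensor U V x y) z) t)"

text \<open>The map \<open>id \<otimes> \<gamma> \<otimes> id\<close> from \<open>(U \<otimes> V) \<otimes> (W \<otimes> X)\<close> to \<open>(U \<otimes> W) \<otimes> (V \<otimes> X)\<close>, with the
  coherence isomorphisms made explicit.\<close>

definition middle_exchange ::
  "('a, 'u) module \<Rightarrow> ('a, 'v) module \<Rightarrow> ('a, 'w) module \<Rightarrow> ('a, 'x) module
    \<Rightarrow> (('u \<times> 'v \<Rightarrow> 'a) set \<times> ('w \<times> 'x \<Rightarrow> 'a) set \<Rightarrow> 'a) set
    \<Rightarrow> (('u \<times> 'w \<Rightarrow> 'a) set \<times> ('v \<times> 'x \<Rightarrow> 'a) set \<Rightarrow> 'a) set" where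
  "middle_exchange U V W X =
     associator_inv U W (V \<otimes>\<^sub>V X)
     \<circ> tensor_map U (V \<otimes>\<^sub>V (W \<otimes>\<^sub>V X)) U (W \<otimes>\<^sub>V (V \<otimes>\<^sub>V X)) id
         (associator W V X
          \<circ> tensor_map (V \<otimes>\<^sub>V W) X (W \<otimes>\<^sub>V V) X (symmetry V W) id
          \<circ> associator_inv V W X)
     \<circ> associator U V (W \<otimes>\<^sub>V X)"

end

section \<open>Binomial bimonoids\<close>

record ('a, 'v) graded_bimonoid =
  gr :: "nat \<Rightarrow> ('a, 'v) module"
  nabla :: "nat \<Rightarrow> nat \<Rightarrow> ('v \<times> 'v \<Rightarrow> 'a) set \<Rightarrow> 'v"
  Delta :: "nat \<Rightarrow> nat \<Rightarrow> 'v \<Rightarrow> ('v \<times> 'v \<Rightarrow> 'a) set"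
  eta :: "'a \<Rightarrow> 'v"
  eps :: "'v \<Rightarrow> 'a"

locale binomial_bimonoid = field +
  fixes A :: "('a, 'v) graded_bimonoid"
  assumes vectorspace_gr: "\<And>n. vectorspace R (gr A n)"
    and nabla_hom: "\<And>n p. nabla A n p \<in> module_hom R (gr A n \<otimes>\<^sub>V gr A p) (gr A (n + p))"
    and Delta_hom: "\<And>n p. Delta A n p \<in> module_hom R (gr A (n + p)) (gr A n \<otimes>\<^sub>V gr A p)"
    and eta_hom: "eta A \<in> module_hom R unit_space (gr A 0)"
    and eps_hom: "eps A \<in> module_hom R (gr A 0) unit_space"
    and unit: "\<And>n t. t \<in> carrier (unit_space \<otimes>\<^sub>V gr A n) \<Longrightarrow>
      nabla A 0 n (tensor_map unit_space (gr A n) (gr A 0) (gr A n) (eta A) id t)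
      = left_unitor (gr A n) t"
    and assoc: "\<And>n p q t. t \<in> carrier (gr A n \<otimes>\<^sub>V gr A p \<otimes>\<^sub>V gr A q) \<Longrightarrow>
      nabla A (n + p) q
        (tensor_map (gr A n \<otimes>\<^sub>V gr A p) (gr A q) (gr A (n + p)) (gr A q) (nabla A n p) id t)
      = nabla A n (p + q)
        (tensor_map (gr A n) (gr A p \<otimes>\<^sub>V gr A q) (gr A n) (gr A (p + q)) id (nabla A p q)
          (associator (gr A n) (gr A p) (gr A q) t))"
    and comm: "\<And>n p t. t \<in> carrier (gr A n \<otimes>\<^sub>V gr A p) \<Longrightarrow>
      nabla A p n (symmetry (gr A n) (gr A p) t) = nabla A n p t"
    and counit: "\<And>n x. x \<in> carrier (gr A n) \<Longrightarrow>
      left_unitor (gr A n)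
        (tensor_map (gr A 0) (gr A n) unit_space (gr A n) (eps A) id (Delta A 0 n x)) = x"
    and coassoc: "\<And>n p q x. x \<in> carrier (gr A (n + p + q)) \<Longrightarrow>
      associator (gr A n) (gr A p) (gr A q)
        (tensor_map (gr A (n + p)) (gr A q) (gr A n \<otimes>\<^sub>V gr A p) (gr A q) (Delta A n p) id
          (Delta A (n + p) q x))
      = tensor_map (gr A n) (gr A (p + q)) (gr A n) (gr A p \<otimes>\<^sub>V gr A q) id (Delta A p q)
          (Delta A n (p + q) x)"
    and cocomm: "\<And>n p x. x \<in> carrier (gr A (n + p)) \<Longrightarrow>
      symmetry (gr A n) (gr A p) (Delta A n p x) = Delta A p n x"
    and nabla_eps: "\<And>t. t \<in> carrier (gr A 0 \<otimes>\<^sub>V gr A 0) \<Longrightarrow>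
      eps A (nabla A 0 0 t)
      = left_unitor unit_space
          (tensor_map (gr A 0) (gr A 0) unit_space unit_space (eps A) (eps A) t)"
    and eta_Delta: "\<And>c. c \<in> carrier R \<Longrightarrow>
      Delta A 0 0 (eta A c)
      = tensor_map unit_space unit_space (gr A 0) (gr A 0) (eta A) (eta A)
          (left_unitor_inv unit_space c)"
    and eta_eps: "\<And>c. c \<in> carrier R \<Longrightarrow> eps A (eta A c) = c"
    and nabla_Delta: "\<And>n p q r t. n + p = q + r \<Longrightarrow> t \<in> carrier (gr A n \<otimes>\<^sub>V gr A p) \<Longrightarrow>
      Delta A q r (nabla A n p t)
      = finsum (gr A q \<otimes>\<^sub>V gr A r)
          (\<lambda>(a, b, c, d).
            tensor_map (gr A a \<otimes>\<^sub>V gr A c) (gr A b \<otimes>\<^sub>V gr A d) (gr A q) (gr A r)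
              (nabla A a c) (nabla A b d)
            (middle_exchange (gr A a) (gr A b) (gr A c) (gr A d)
            (tensor_map (gr A n) (gr A p) (gr A a \<otimes>\<^sub>V gr A b) (gr A c \<otimes>\<^sub>V gr A d)
              (Delta A a b) (Delta A c d) t)))
          {(a, b, c, d). a + b = n \<and> c + d = p \<and> a + c = q \<and> b + d = r}"
    and eps_eta: "\<And>x. x \<in> carrier (gr A 0) \<Longrightarrow> eta A (eps A x) = x"
    and Delta_nabla: "\<And>n p x. x \<in> carrier (gr A (n + p)) \<Longrightarrow>
      nabla A n p (Delta A n p x) = [((n + p) choose n)] \<cdot>\<^bsub>gr A (n + p)\<^esub> x"

context field
begin

definition binomial_bimonoid_hom ::
  "('a, 'v) graded_bimonoid \<Rightarrow> ('a, 'w) graded_bimonoid \<Rightarrow> (nat \<Rightarrow> 'v \<Rightarrow> 'w) \<Rightarrow> bool" where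
  "binomial_bimonoid_hom A B f \<longleftrightarrow>
     (\<forall>n. f n \<in> module_hom R (gr A n) (gr B n)) \<and>
     (\<forall>c\<in>carrier R. f 0 (eta A c) = eta B c) \<and>
     (\<forall>x\<in>carrier (gr A 0). eps B (f 0 x) = eps A x) \<and>
     (\<forall>n p. \<forall>t\<in>carrier (gr A n \<otimes>\<^sub>V gr A p).
        nabla B n p (tensor_map (gr A n) (gr A p) (gr B n) (gr B p) (f n) (f p) t)
        = f (n + p) (nabla A n p t)) \<and>
     (\<forall>n p. \<forall>x\<in>carrier (gr A (n + p)).
        tensor_map (gr A n) (gr A p) (gr B n) (gr B p) (f n) (f p) (Delta A n p x)
        = Delta B n p (f (n + p) x))"

definition binomial_bimonoid_isomorphic ::
  "('a, 'v) graded_bimonoid \<Rightarrow> ('a, 'w) graded_bimonoid \<Rightarrow> bool" where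
  "binomial_bimonoid_isomorphic A B \<longleftrightarrow>
     (\<exists>f g. binomial_bimonoid_hom A B f \<and> binomial_bimonoid_hom B A g \<and>
       (\<forall>n. \<forall>x\<in>carrier (gr A n). g n (f n x) = x) \<and>
       (\<forall>n. \<forall>y\<in>carrier (gr B n). f n (g n y) = y))"

definition graded_isomorphic ::
  "(nat \<Rightarrow> ('a, 'v) module) \<Rightarrow> (nat \<Rightarrow> ('a, 'w) module) \<Rightarrow> bool" where
  "graded_isomorphic V W \<longleftrightarrow>
     (\<exists>f g. (\<forall>n. f n \<in> module_hom R (V n) (W n)) \<and> (\<forall>n. g n \<in> module_hom R (W n) (V n)) \<and>
       (\<forall>n. \<forall>x\<in>carrier (V n). g n (f n x) = x) \<and>
       (\<forall>n. \<forall>y\<in>carrier (W n). f n (g n y) = y))"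

end

end

theory Submission
  imports Defs
begin

text \<open>Take \<open>A n = B n\<close> to be a line for every \<open>n\<close>, with \<open>A\<close> the symmetric powers of a line
  (\<open>\<nabla>\<close> is multiplication by \<open>1\<close> and \<open>\<Delta>\<close> by \<open>n + p choose n\<close>) and \<open>B\<close> the divided powers, where
  these two scalars are exchanged. Both are binomial bimonoids, axiom (x) being Vandermonde's identity.
  If \<open>N > 0\<close> vanishes in the field, then \<open>\<nabla> 1 (N - 1)\<close> is nonzero on \<open>A\<close>, but on \<open>B\<close> it is
  multiplication by \<open>N choose 1 = 0\<close>, so the two are not isomorphic.\<close>

section \<open>Universal property of the tensor product\<close>

text \<open>Axiom (xii) fixes only the product of the two scalars, so the factor
  \<open>n + p choose n\<close> may be placed on either side. In characteristic zero, rescaling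
  degree \<open>n\<close> by the factorial of \<open>n\<close> would identify the two choices; once
  a positive multiple of one vanishes, these factorials are zero from some degree on. The main
  obstacle is the concrete tensor product: tensors are cosets in a free space, and maps out of them
  are read off with \<open>the_elem\<close>, so nothing can be evaluated before the universal
  property is available. Each structural map is therefore shown to be linear and given its value on
  pure tensors. A tensor product of lines is generated by one pure tensor, so each axiom reduces to
  at most one equation between natural numbers, and the field enters only through their image in
  it.\<close>

context field
begin

section \<open>Free vector spaces and linear extension\<close>

lemma free_space_carrier_iff:
  "\<phi> \<in> carrier (free_space S) \<longleftrightarrow> \<phi> \<in> S \<rightarrow>\<^sub>E carrier R \<and> finite {s \<in> S. \<phi> s \<noteq> \<zero>}"
  by (simp add: free_space_def func_space_def)

lemma free_space_simps [simp]:
  "\<zero>\<^bsub>free_space S\<^esub> = (\<lambda>s\<in>S. \<zero>)"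
  "\<phi> \<oplus>\<^bsub>free_space S\<^esub> \<psi> = (\<lambda>s\<in>S. \<phi> s \<oplus> \<psi> s)"
  "c \<odot>\<^bsub>free_space S\<^esub> \<phi> = (\<lambda>s\<in>S. c \<otimes> \<phi> s)"
  by (simp_all add: free_space_def func_space_def)

lemma free_space_module: "module R (free_space S)"
proof -
  interpret F: module R "func_space S" by (rule func_space_is_module)
  have "submodule R (carrier (free_space S)) (func_space S)"
  proof (unfold_locales)
    show "carrier (free_space S) \<subseteq> carrier (func_space S)"
      by (auto simp: free_space_def)
    show "\<zero>\<^bsub>func_space S\<^esub> \<in> carrier (free_space S)"
      by (auto simp: free_space_carrier_iff func_space_def)
  next
    fix v w assume v: "v \<in> carrier (free_space S)" and w: "w \<in> carrier (free_space S)"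
    have "{s \<in> S. v s \<oplus> w s \<noteq> \<zero>} \<subseteq> {s \<in> S. v s \<noteq> \<zero>} \<union> {s \<in> S. w s \<noteq> \<zero>}"
      by auto
    then have "finite {s \<in> S. v s \<oplus> w s \<noteq> \<zero>}"
      using v w by (auto simp: free_space_carrier_iff intro: finite_subset)
    then show "v \<oplus>\<^bsub>func_space S\<^esub> w \<in> carrier (free_space S)"
      using v w by (auto simp: free_space_carrier_iff func_space_def PiE_mem cong: conj_cong)
  next
    fix c v assume c: "c \<in> carrier R" and v: "v \<in> carrier (free_space S)"
    have "{s \<in> S. c \<otimes> v s \<noteq> \<zero>} \<subseteq> {s \<in> S. v s \<noteq> \<zero>}"
      using c by auto
    then have "finite {s \<in> S. c \<otimes> v s \<noteq> \<zero>}"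
      using v by (auto simp: free_space_carrier_iff intro: finite_subset)
    then show "c \<odot>\<^bsub>func_space S\<^esub> v \<in> carrier (free_space S)"
      using c v by (auto simp: free_space_carrier_iff func_space_def PiE_mem cong: conj_cong)
  qed
  from F.submodule_is_module[OF this] show ?thesis
    by (simp add: free_space_def)
qed

lemma free_basis_closed [simp]: "s \<in> S \<Longrightarrow> free_basis S s \<in> carrier (free_space S)"
proof -
  assume s: "s \<in> S"
  then have "{t \<in> S. free_basis S s t \<noteq> \<zero>} = {s}"
    by (auto simp: free_basis_def)
  with s show ?thesis
    by (auto simp: free_space_carrier_iff free_basis_def)
qed

text \<open>Induction on the finite support, one point at a time. The \<open>basis\<close> case
  carries a coefficient, so closure under scalars is not a separate case.\<close>

lemma free_space_induct [consumes 1, case_names zero basis add]: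
  assumes \<phi>: "\<phi> \<in> carrier (free_space S)"
    and zero: "P \<zero>\<^bsub>free_space S\<^esub>"
    and basis: "\<And>c s. c \<in> carrier R \<Longrightarrow> s \<in> S \<Longrightarrow> P (c \<odot>\<^bsub>free_space S\<^esub> free_basis S s)"
    and add: "\<And>\<phi> \<psi>. \<phi> \<in> carrier (free_space S) \<Longrightarrow> \<psi> \<in> carrier (free_space S) \<Longrightarrow>
      P \<phi> \<Longrightarrow> P \<psi> \<Longrightarrow> P (\<phi> \<oplus>\<^bsub>free_space S\<^esub> \<psi>)"
  shows "P \<phi>"
proof -
  interpret F: module R "free_space S" by (rule free_space_module)
  have "P \<phi>" if "finite T" "\<phi> \<in> S \<rightarrow>\<^sub>E carrier R" "{s \<in> S. \<phi> s \<noteq> \<zero>} = T" for T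
    using that
  proof (induction T arbitrary: \<phi> rule: finite_induct)
    case empty
    have "\<phi> = \<zero>\<^bsub>free_space S\<^esub>"
    proof
      fix s
      show "\<phi> s = \<zero>\<^bsub>free_space S\<^esub> s"
        using empty PiE_arb[OF empty(1)] by (cases "s \<in> S") auto
    qed
    with zero show ?case by (simp only:)
  next
    case (insert s T)
    have "s \<in> {s \<in> S. \<phi> s \<noteq> \<zero>}"
      unfolding insert.prems(2) by simp
    then have s: "s \<in> S" "\<phi> s \<in> carrier R"
      using insert.prems(1) by auto
    \<comment> \<open>\<open>\<psi>\<close> is \<open>\<phi>\<close> with its value at
      \<open>s\<close> erased, so its support loses exactly \<open>s\<close>.\<close>
    define \<psi> where "\<psi> = (\<lambda>t\<in>S. if t = s then \<zero> else \<phi> t)"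
    have "{t \<in> S. \<psi> t \<noteq> \<zero>} = {t \<in> S. \<phi> t \<noteq> \<zero>} - {s}"
      by (auto simp: \<psi>_def)
    then have "{t \<in> S. \<psi> t \<noteq> \<zero>} = T"
      unfolding insert.prems(2) using insert.hyps by simp
    moreover have "\<psi> \<in> S \<rightarrow>\<^sub>E carrier R"
      using insert.prems(1) by (auto simp: \<psi>_def)
    ultimately have \<psi>: "\<psi> \<in> S \<rightarrow>\<^sub>E carrier R" "{t \<in> S. \<psi> t \<noteq> \<zero>} = T"
      by simp_all
    have "\<phi> = \<phi> s \<odot>\<^bsub>free_space S\<^esub> free_basis S s \<oplus>\<^bsub>free_space S\<^esub> \<psi>"
    proof
      fix t
      show "\<phi> t = (\<phi> s \<odot>\<^bsub>free_space S\<^esub> free_basis S s \<oplus>\<^bsub>free_space S\<^esub> \<psi>) t"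
        using PiE_mem[OF insert.prems(1)] PiE_arb[OF insert.prems(1)] s
        by (cases "t \<in> S") (auto simp: free_basis_def \<psi>_def)
    qed
    moreover have "\<psi> \<in> carrier (free_space S)"
      using \<psi> insert.hyps by (simp add: free_space_carrier_iff)
    moreover have "P \<psi>" using insert.IH \<psi> by blast
    ultimately show ?case
      using add[OF F.smult_closed _ basis] s free_basis_closed by metis
  qed
  with \<phi> show ?thesis
    by (auto simp: free_space_carrier_iff)
qed

text \<open>The linear extension of \<open>g\<close>. Summing over the support avoids the default
  value of \<open>finsum\<close> on infinite sets, and makes this literally the sum inside
  \<open>tensor_lift\<close> when \<open>g s\<close> is
  \<open>\<beta> (fst s) (snd s)\<close>.\<close>

definition free_lift :: "'s set \<Rightarrow> ('a, 'u) module \<Rightarrow> ('s \<Rightarrow> 'u) \<Rightarrow> ('s \<Rightarrow> 'a) \<Rightarrow> 'u" where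
  "free_lift S U g \<phi> = (\<Oplus>\<^bsub>U\<^esub>s\<in>{s \<in> S. \<phi> s \<noteq> \<zero>}. \<phi> s \<odot>\<^bsub>U\<^esub> g s)"

text \<open>Supports change under addition and scaling, possibly by cancellation. A fixed finite
  index set lets such sums be compared term by term.\<close>

lemma free_lift_superset:
  assumes "module R U" "g \<in> S \<rightarrow> carrier U" "\<phi> \<in> carrier (free_space S)"
    and T: "finite T" "{s \<in> S. \<phi> s \<noteq> \<zero>} \<subseteq> T" "T \<subseteq> S"
  shows "free_lift S U g \<phi> = (\<Oplus>\<^bsub>U\<^esub>s\<in>T. \<phi> s \<odot>\<^bsub>U\<^esub> g s)"
proof -
  interpret U: module R U by fact
  have g: "\<And>s. s \<in> T \<Longrightarrow> g s \<in> carrier U" and \<phi>: "\<And>s. s \<in> T \<Longrightarrow> \<phi> s \<in> carrier R"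
    using assms by (auto simp: free_space_carrier_iff)
  show ?thesis
    unfolding free_lift_def
    by (rule U.add.finprod_mono_neutral_cong_left) (use T g \<phi> in auto)
qed

lemma free_lift_hom:
  assumes "module R U" and g: "g \<in> S \<rightarrow> carrier U"
  shows "free_lift S U g \<in> module_hom R (free_space S) U"
proof -
  interpret U: module R U by fact
  interpret F: module R "free_space S" by (rule free_space_module)
  have closed: "free_lift S U g \<phi> \<in> carrier U" if "\<phi> \<in> carrier (free_space S)" for \<phi>
    unfolding free_lift_def
    using that g by (intro U.finsum_closed) (auto simp: free_space_carrier_iff)
  have supp: "finite {s \<in> S. \<phi> s \<noteq> \<zero>}" "\<And>s. s \<in> S \<Longrightarrow> \<phi> s \<in> carrier R"
    if "\<phi> \<in> carrier (free_space S)" for \<phi>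
    using that by (auto simp: free_space_carrier_iff)
  have "free_lift S U g (\<phi> \<oplus>\<^bsub>free_space S\<^esub> \<psi>) = free_lift S U g \<phi> \<oplus>\<^bsub>U\<^esub> free_lift S U g \<psi>"
    if \<phi>: "\<phi> \<in> carrier (free_space S)" and \<psi>: "\<psi> \<in> carrier (free_space S)" for \<phi> \<psi>
  proof -
    define T where "T = {s \<in> S. \<phi> s \<noteq> \<zero>} \<union> {s \<in> S. \<psi> s \<noteq> \<zero>}"
    have T: "finite T" "T \<subseteq> S"
      using supp \<phi> \<psi> by (auto simp: T_def)
    have "free_lift S U g (\<phi> \<oplus>\<^bsub>free_space S\<^esub> \<psi>)
        = (\<Oplus>\<^bsub>U\<^esub>s\<in>T. (\<phi> \<oplus>\<^bsub>free_space S\<^esub> \<psi>) s \<odot>\<^bsub>U\<^esub> g s)"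
      by (rule free_lift_superset[OF assms F.a_closed[OF \<phi> \<psi>]]) (use T in \<open>auto simp: T_def\<close>)
    also have "\<dots> = (\<Oplus>\<^bsub>U\<^esub>s\<in>T. \<phi> s \<odot>\<^bsub>U\<^esub> g s \<oplus>\<^bsub>U\<^esub> \<psi> s \<odot>\<^bsub>U\<^esub> g s)"
      by (rule U.finsum_cong') (use T g supp \<phi> \<psi> in \<open>auto simp: U.smult_l_distr subset_iff Pi_iff\<close>)
    also have "\<dots> = (\<Oplus>\<^bsub>U\<^esub>s\<in>T. \<phi> s \<odot>\<^bsub>U\<^esub> g s) \<oplus>\<^bsub>U\<^esub> (\<Oplus>\<^bsub>U\<^esub>s\<in>T. \<psi> s \<odot>\<^bsub>U\<^esub> g s)"
      by (rule U.finsum_addf) (use T g supp \<phi> \<psi> in \<open>auto simp: subset_iff Pi_iff\<close>)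
    also have "\<dots> = free_lift S U g \<phi> \<oplus>\<^bsub>U\<^esub> free_lift S U g \<psi>"
      using free_lift_superset[OF assms \<phi> T(1) _ T(2)] free_lift_superset[OF assms \<psi> T(1) _ T(2)]
      by (simp add: T_def)
    finally show ?thesis .
  qed
  moreover have "free_lift S U g (c \<odot>\<^bsub>free_space S\<^esub> \<phi>) = c \<odot>\<^bsub>U\<^esub> free_lift S U g \<phi>"
    if c: "c \<in> carrier R" and \<phi>: "\<phi> \<in> carrier (free_space S)" for c \<phi>
  proof -
    define T where "T = {s \<in> S. \<phi> s \<noteq> \<zero>}"
    have T: "finite T" "T \<subseteq> S"
      using supp \<phi> by (auto simp: T_def)
    have "free_lift S U g (c \<odot>\<^bsub>free_space S\<^esub> \<phi>)
        = (\<Oplus>\<^bsub>U\<^esub>s\<in>T. (c \<odot>\<^bsub>free_space S\<^esub> \<phi>) s \<odot>\<^bsub>U\<^esub> g s)"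
      by (rule free_lift_superset[OF assms F.smult_closed[OF c \<phi>]])
        (use T c in \<open>auto simp: T_def\<close>)
    also have "\<dots> = (\<Oplus>\<^bsub>U\<^esub>s\<in>T. c \<odot>\<^bsub>U\<^esub> (\<phi> s \<odot>\<^bsub>U\<^esub> g s))"
      by (rule U.finsum_cong') (use T c g supp \<phi> in \<open>auto simp: U.smult_assoc1 subset_iff Pi_iff\<close>)
    also have "\<dots> = c \<odot>\<^bsub>U\<^esub> free_lift S U g \<phi>"
      unfolding free_lift_def T_def[symmetric]
      by (rule U.finsum_smult_ldistr[symmetric])
        (use T c g supp \<phi> in \<open>auto simp: subset_iff Pi_iff\<close>)
    finally show ?thesis .
  qed
  ultimately show ?thesis
    using closed by (auto simp: module_hom_def)
qed

lemma free_lift_basis: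
  assumes "module R U" "g \<in> S \<rightarrow> carrier U" "s \<in> S"
  shows "free_lift S U g (free_basis S s) = g s"
proof -
  interpret U: module R U by fact
  have "{t \<in> S. free_basis S s t \<noteq> \<zero>} = {s}"
    using assms by (auto simp: free_basis_def)
  then show ?thesis
    using assms by (simp add: free_lift_def free_basis_def Pi_iff)
qed

section \<open>The tensor product as a quotient of a free space\<close>

lemma bilinear_relations_closed:
  assumes "module R V" "module R W"
  shows "bilinear_relations V W \<subseteq> carrier (free_space (carrier V \<times> carrier W))"
proof -
  interpret V: module R V by fact
  interpret W: module R W by fact
  interpret F: module R "free_space (carrier V \<times> carrier W)" by (rule free_space_module)
  show ?thesis
    unfolding bilinear_relations_def Let_def
    by (auto intro!: F.minus_closed F.a_closed F.smult_closed free_basis_closed simp del: free_space_simps)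
qed

lemma bilinear_span_submodule:
  assumes "module R V" "module R W"
  shows "submodule R (bilinear_span V W) (free_space (carrier V \<times> carrier W))"
proof -
  interpret F: module R "free_space (carrier V \<times> carrier W)" by (rule free_space_module)
  show ?thesis
    unfolding bilinear_span_def
    by (rule F.span_is_submodule[OF bilinear_relations_closed[OF assms]])
qed

text \<open>Makes coset arithmetic available for the span. Closure under negation comes from scaling
  by minus one.\<close>

lemma bilinear_span_subgroup:
  assumes "module R V" "module R W"
  shows "abelian_subgroup (bilinear_span V W) (free_space (carrier V \<times> carrier W))"
proof -
  interpret F: module R "free_space (carrier V \<times> carrier W)" by (rule free_space_module)
  interpret N: submodule R "bilinear_span V W" "free_space (carrier V \<times> carrier W)"
    by (rule bilinear_span_submodule[OF assms])
  show ?thesis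
  proof (rule abelian_subgroupI3)
    show "additive_subgroup (bilinear_span V W) (free_space (carrier V \<times> carrier W))"
    proof (rule additive_subgroup.intro, rule F.add.subgroupI)
      fix a assume a: "a \<in> bilinear_span V W"
      then have "\<ominus> \<one> \<odot>\<^bsub>free_space (carrier V \<times> carrier W)\<^esub> a \<in> bilinear_span V W"
        by (intro N.smult_closed) simp_all
      moreover have "a \<in> carrier (free_space (carrier V \<times> carrier W))"
        using a N.subset by blast
      ultimately show "\<ominus>\<^bsub>free_space (carrier V \<times> carrier W)\<^esub> a \<in> bilinear_span V W"
        by (simp only: F.smult_minus_1)
    next
      show "bilinear_span V W \<noteq> {}"
        using N.zero_closed by blast
    qed (fact N.subset N.m_closed)+
  qed (rule F.abelian_group_axioms)
qed

lemma tensor_carrier: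
  assumes "module R V" "module R W"
  shows "carrier (V \<otimes>\<^sub>V W) = (\<lambda>\<phi>. bilinear_span V W +>\<^bsub>free_space (carrier V \<times> carrier W)\<^esub> \<phi>) `
    carrier (free_space (carrier V \<times> carrier W))"
  by (auto simp: tensor_def Let_def A_RCOSETS_def')

lemma tensor_zero_coset:
  assumes "module R V" "module R W"
  shows "\<zero>\<^bsub>V \<otimes>\<^sub>V W\<^esub> = bilinear_span V W +>\<^bsub>free_space (carrier V \<times> carrier W)\<^esub>
    \<zero>\<^bsub>free_space (carrier V \<times> carrier W)\<^esub>"
proof -
  interpret N: abelian_subgroup "bilinear_span V W" "free_space (carrier V \<times> carrier W)"
    by (rule bilinear_span_subgroup[OF assms])
  show ?thesis
    using N.a_coset_add_zero[OF N.a_subset] by (simp add: tensor_def Let_def del: free_space_simps)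
qed

lemma tensor_add_coset:
  assumes "module R V" "module R W"
    and "\<phi> \<in> carrier (free_space (carrier V \<times> carrier W))"
    and "\<psi> \<in> carrier (free_space (carrier V \<times> carrier W))"
  shows "(bilinear_span V W +>\<^bsub>free_space (carrier V \<times> carrier W)\<^esub> \<phi>) \<oplus>\<^bsub>V \<otimes>\<^sub>V W\<^esub>
      (bilinear_span V W +>\<^bsub>free_space (carrier V \<times> carrier W)\<^esub> \<psi>)
    = bilinear_span V W +>\<^bsub>free_space (carrier V \<times> carrier W)\<^esub>
      (\<phi> \<oplus>\<^bsub>free_space (carrier V \<times> carrier W)\<^esub> \<psi>)"
proof -
  interpret N: abelian_subgroup "bilinear_span V W" "free_space (carrier V \<times> carrier W)"
    by (rule bilinear_span_subgroup[OF assms(1,2)])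
  show ?thesis
    using N.a_rcos_sum[OF assms(3,4)] by (simp add: tensor_def Let_def del: free_space_simps)
qed

text \<open>The scalar multiple of a coset is a union over all its representatives. Two
  representatives differ by an element of the span, and so do their multiples; hence all cosets in
  the union coincide.\<close>

lemma tensor_smult_coset:
  assumes "module R V" "module R W"
    and c: "c \<in> carrier R" and \<phi>: "\<phi> \<in> carrier (free_space (carrier V \<times> carrier W))"
  shows "c \<odot>\<^bsub>V \<otimes>\<^sub>V W\<^esub> (bilinear_span V W +>\<^bsub>free_space (carrier V \<times> carrier W)\<^esub> \<phi>)
    = bilinear_span V W +>\<^bsub>free_space (carrier V \<times> carrier W)\<^esub>
      (c \<odot>\<^bsub>free_space (carrier V \<times> carrier W)\<^esub> \<phi>)"
proof -
  let ?F = "free_space (carrier V \<times> carrier W)" and ?N = "bilinear_span V W"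
  interpret F: module R ?F by (rule free_space_module)
  interpret N: abelian_subgroup ?N ?F
    by (rule bilinear_span_subgroup[OF assms(1,2)])
  interpret S: submodule R ?N ?F
    by (rule bilinear_span_submodule[OF assms(1,2)])
  have "?N +>\<^bsub>?F\<^esub> (c \<odot>\<^bsub>?F\<^esub> \<psi>) = ?N +>\<^bsub>?F\<^esub> (c \<odot>\<^bsub>?F\<^esub> \<phi>)" if "\<psi> \<in> ?N +>\<^bsub>?F\<^esub> \<phi>" for \<psi>
  proof -
    from that obtain n where n: "n \<in> ?N" and \<psi>: "\<psi> = n \<oplus>\<^bsub>?F\<^esub> \<phi>"
      by (auto simp: a_r_coset_def' simp del: free_space_simps)
    have nF: "n \<in> carrier ?F"
      using n S.subset by blast
    have "c \<odot>\<^bsub>?F\<^esub> \<psi> = c \<odot>\<^bsub>?F\<^esub> n \<oplus>\<^bsub>?F\<^esub> c \<odot>\<^bsub>?F\<^esub> \<phi>"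
      unfolding \<psi> by (rule F.smult_r_distr[OF c nF \<phi>])
    moreover have "c \<odot>\<^bsub>?F\<^esub> n \<in> ?N"
      by (rule S.smult_closed[OF c n])
    ultimately have "c \<odot>\<^bsub>?F\<^esub> \<psi> \<in> ?N +>\<^bsub>?F\<^esub> (c \<odot>\<^bsub>?F\<^esub> \<phi>)"
      unfolding a_r_coset_def' by blast
    from N.a_repr_independence'[OF this F.smult_closed[OF c \<phi>]] show ?thesis
      by (rule sym)
  qed
  moreover have "\<phi> \<in> ?N +>\<^bsub>?F\<^esub> \<phi>"
    by (rule N.a_rcos_self[OF \<phi>])
  ultimately have "(\<Union>\<psi>\<in>?N +>\<^bsub>?F\<^esub> \<phi>. ?N +>\<^bsub>?F\<^esub> (c \<odot>\<^bsub>?F\<^esub> \<psi>)) = ?N +>\<^bsub>?F\<^esub> (c \<odot>\<^bsub>?F\<^esub> \<phi>)"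
    by blast
  then show ?thesis
    by (simp only: tensor_def Let_def module.simps)
qed

text \<open>The axioms descend from the free space along the quotient map \<open>q\<close>, which is
  onto and respects zero, addition and scalars.\<close>

lemma tensor_module:
  assumes "module R V" "module R W"
  shows "module R (V \<otimes>\<^sub>V W)"
proof -
  let ?F = "free_space (carrier V \<times> carrier W)" and ?T = "V \<otimes>\<^sub>V W"
  interpret F: module R ?F by (rule free_space_module)
  define q where "q = (\<lambda>\<phi>. bilinear_span V W +>\<^bsub>?F\<^esub> \<phi>)"
  have car: "carrier ?T = q ` carrier ?F"
    unfolding q_def by (rule tensor_carrier[OF assms])
  have zero: "\<zero>\<^bsub>?T\<^esub> = q \<zero>\<^bsub>?F\<^esub>"
    unfolding q_def by (rule tensor_zero_coset[OF assms])
  have add: "q \<phi> \<oplus>\<^bsub>?T\<^esub> q \<psi> = q (\<phi> \<oplus>\<^bsub>?F\<^esub> \<psi>)" if "\<phi> \<in> carrier ?F" "\<psi> \<in> carrier ?F" for \<phi> \<psi>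
    unfolding q_def by (rule tensor_add_coset[OF assms that])
  have smult: "c \<odot>\<^bsub>?T\<^esub> q \<phi> = q (c \<odot>\<^bsub>?F\<^esub> \<phi>)" if "c \<in> carrier R" "\<phi> \<in> carrier ?F" for c \<phi>
    unfolding q_def by (rule tensor_smult_coset[OF assms that])
  note simps = car zero add smult F.a_closed F.smult_closed F.zero_closed F.a_assoc
    F.smult_l_distr F.smult_r_distr F.smult_assoc1 F.smult_one F.r_zero
  show ?thesis
  proof (rule module_criteria)
    show "\<forall>v\<in>carrier ?T. \<exists>w\<in>carrier ?T. v \<oplus>\<^bsub>?T\<^esub> w = \<zero>\<^bsub>?T\<^esub>"
    proof
      fix v assume "v \<in> carrier ?T"
      then obtain \<phi> where \<phi>: "\<phi> \<in> carrier ?F" "v = q \<phi>"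
        by (auto simp: car simp del: free_space_simps)
      have "v \<oplus>\<^bsub>?T\<^esub> q (\<ominus>\<^bsub>?F\<^esub> \<phi>) = \<zero>\<^bsub>?T\<^esub>"
        using \<phi> F.r_neg[OF \<phi>(1)] by (simp add: add zero F.a_inv_closed del: free_space_simps)
      then show "\<exists>w\<in>carrier ?T. v \<oplus>\<^bsub>?T\<^esub> w = \<zero>\<^bsub>?T\<^esub>"
        using F.a_inv_closed[OF \<phi>(1)] car by blast
    qed
    show "\<forall>v w. v \<in> carrier ?T \<and> w \<in> carrier ?T \<longrightarrow> v \<oplus>\<^bsub>?T\<^esub> w = w \<oplus>\<^bsub>?T\<^esub> v"
      using F.a_comm by (auto simp: car add simp del: free_space_simps)
  qed (auto simp: simps is_cring simp del: free_space_simps)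
qed

lemma pure_tensor_closed:
  assumes "module R V" "module R W" "x \<in> carrier V" "y \<in> carrier W"
  shows "pure_tensor V W x y \<in> carrier (V \<otimes>\<^sub>V W)"
  using assms by (simp add: tensor_carrier pure_tensor_def)

text \<open>Turns a generating relation into an equation between cosets: the difference of the
  representatives lies in the span.\<close>

lemma bilinear_relation_pure:
  assumes "module R V" "module R W"
    and "\<phi> \<in> carrier (free_space (carrier V \<times> carrier W))"
    and "\<psi> \<in> carrier (free_space (carrier V \<times> carrier W))"
    and "\<phi> \<ominus>\<^bsub>free_space (carrier V \<times> carrier W)\<^esub> \<psi> \<in> bilinear_relations V W"
  shows "bilinear_span V W +>\<^bsub>free_space (carrier V \<times> carrier W)\<^esub> \<phi>
    = bilinear_span V W +>\<^bsub>free_space (carrier V \<times> carrier W)\<^esub> \<psi>"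
proof -
  let ?F = "free_space (carrier V \<times> carrier W)" and ?N = "bilinear_span V W"
  interpret F: module R ?F by (rule free_space_module)
  interpret N: abelian_subgroup ?N ?F
    by (rule bilinear_span_subgroup[OF assms(1,2)])
  have "\<phi> \<ominus>\<^bsub>?F\<^esub> \<psi> \<in> ?N"
    unfolding bilinear_span_def
    using F.in_own_span[OF bilinear_relations_closed[OF assms(1,2)]] assms(5) by blast
  then have "\<phi> \<in> ?N +>\<^bsub>?F\<^esub> \<psi>"
    using N.a_rcos_module_rev[OF assms(4,3)] by (simp only: a_minus_def)
  from N.a_repr_independence'[OF this assms(4)] show ?thesis
    by (rule sym)
qed

section \<open>Bilinear maps and their factorisation through the tensor product\<close>

definition bilinear ::
  "('a, 'v) module \<Rightarrow> ('a, 'w) module \<Rightarrow> ('a, 'u) module \<Rightarrow> ('v \<Rightarrow> 'w \<Rightarrow> 'u) \<Rightarrow> bool" where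
  "bilinear V W U \<beta> \<longleftrightarrow>
    (\<forall>y\<in>carrier W. (\<lambda>x. \<beta> x y) \<in> module_hom R V U) \<and>
    (\<forall>x\<in>carrier V. \<beta> x \<in> module_hom R W U)"

lemma bilinearI:
  assumes "\<And>y. y \<in> carrier W \<Longrightarrow> (\<lambda>x. \<beta> x y) \<in> module_hom R V U"
    and "\<And>x. x \<in> carrier V \<Longrightarrow> (\<lambda>y. \<beta> x y) \<in> module_hom R W U"
  shows "bilinear V W U \<beta>"
  using assms by (simp add: bilinear_def)

lemma bilinear_closed:
  assumes "bilinear V W U \<beta>" "x \<in> carrier V" "y \<in> carrier W"
  shows "\<beta> x y \<in> carrier U"
  using assms module_hom_closed[of "\<beta> x" R W U] by (auto simp: bilinear_def)

text \<open>Each of the four families in \<open>bilinear_relations\<close> supplies one law: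
  additivity or homogeneity in one of the two arguments.\<close>

lemma bilinear_pure_tensor:
  assumes "module R V" "module R W"
  shows "bilinear V W (V \<otimes>\<^sub>V W) (pure_tensor V W)"
proof -
  interpret V: module R V by fact
  interpret W: module R W by fact
  let ?F = "free_space (carrier V \<times> carrier W)" and ?N = "bilinear_span V W"
  let ?d = "free_basis (carrier V \<times> carrier W)"
  interpret F: module R ?F by (rule free_space_module)
  note eq = bilinear_relation_pure[OF assms]
  have dF: "?d (x, y) \<in> carrier ?F" if "x \<in> carrier V" "y \<in> carrier W" for x y
    using that by simp
  show ?thesis
  proof (rule bilinearI)
    fix y assume y: "y \<in> carrier W"
    have "pure_tensor V W (x \<oplus>\<^bsub>V\<^esub> x') y = pure_tensor V W x y \<oplus>\<^bsub>V \<otimes>\<^sub>V W\<^esub> pure_tensor V W x' y"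
      if x: "x \<in> carrier V" "x' \<in> carrier V" for x x'
      unfolding pure_tensor_def tensor_add_coset[OF assms dF[OF x(1) y] dF[OF x(2) y]]
    proof (rule eq)
      show "?d (x \<oplus>\<^bsub>V\<^esub> x', y) \<ominus>\<^bsub>?F\<^esub> (?d (x, y) \<oplus>\<^bsub>?F\<^esub> ?d (x', y)) \<in> bilinear_relations V W"
        unfolding bilinear_relations_def Let_def using x y by blast
    qed (use x y dF in \<open>auto simp del: free_space_simps\<close>)
    moreover have "pure_tensor V W (c \<odot>\<^bsub>V\<^esub> x) y = c \<odot>\<^bsub>V \<otimes>\<^sub>V W\<^esub> pure_tensor V W x y"
      if c: "c \<in> carrier R" "x \<in> carrier V" for c x
      unfolding pure_tensor_def tensor_smult_coset[OF assms c(1) dF[OF c(2) y]]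
    proof (rule eq)
      show "?d (c \<odot>\<^bsub>V\<^esub> x, y) \<ominus>\<^bsub>?F\<^esub> (c \<odot>\<^bsub>?F\<^esub> ?d (x, y)) \<in> bilinear_relations V W"
        unfolding bilinear_relations_def Let_def using c y by blast
    qed (use c y dF in \<open>auto simp del: free_space_simps\<close>)
    ultimately show "(\<lambda>x. pure_tensor V W x y) \<in> module_hom R V (V \<otimes>\<^sub>V W)"
      using y pure_tensor_closed[OF assms] by (auto simp: module_hom_def)
  next
    fix x assume x: "x \<in> carrier V"
    have "pure_tensor V W x (y \<oplus>\<^bsub>W\<^esub> y') = pure_tensor V W x y \<oplus>\<^bsub>V \<otimes>\<^sub>V W\<^esub> pure_tensor V W x y'"
      if y: "y \<in> carrier W" "y' \<in> carrier W" for y y'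
      unfolding pure_tensor_def tensor_add_coset[OF assms dF[OF x y(1)] dF[OF x y(2)]]
    proof (rule eq)
      show "?d (x, y \<oplus>\<^bsub>W\<^esub> y') \<ominus>\<^bsub>?F\<^esub> (?d (x, y) \<oplus>\<^bsub>?F\<^esub> ?d (x, y')) \<in> bilinear_relations V W"
        unfolding bilinear_relations_def Let_def using x y by blast
    qed (use x y dF in \<open>auto simp del: free_space_simps\<close>)
    moreover have "pure_tensor V W x (c \<odot>\<^bsub>W\<^esub> y) = c \<odot>\<^bsub>V \<otimes>\<^sub>V W\<^esub> pure_tensor V W x y"
      if c: "c \<in> carrier R" "y \<in> carrier W" for c y
      unfolding pure_tensor_def tensor_smult_coset[OF assms c(1) dF[OF x c(2)]]
    proof (rule eq)
      show "?d (x, c \<odot>\<^bsub>W\<^esub> y) \<ominus>\<^bsub>?F\<^esub> (c \<odot>\<^bsub>?F\<^esub> ?d (x, y)) \<in> bilinear_relations V W"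
        unfolding bilinear_relations_def Let_def using c x by blast
    qed (use c x dF in \<open>auto simp del: free_space_simps\<close>)
    ultimately show "pure_tensor V W x \<in> module_hom R W (V \<otimes>\<^sub>V W)"
      using x pure_tensor_closed[OF assms] by (auto simp: module_hom_def)
  qed
qed

text \<open>Zero and scalar multiples need no cases: zero is the pure tensor of two zero vectors,
  and a coefficient is absorbed by the left factor.\<close>

lemma tensor_induct [consumes 3, case_names pure add]:
  assumes "module R V" "module R W" and t: "t \<in> carrier (V \<otimes>\<^sub>V W)"
    and pure: "\<And>x y. x \<in> carrier V \<Longrightarrow> y \<in> carrier W \<Longrightarrow> P (pure_tensor V W x y)"
    and add: "\<And>t u. t \<in> carrier (V \<otimes>\<^sub>V W) \<Longrightarrow> u \<in> carrier (V \<otimes>\<^sub>V W) \<Longrightarrow>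
      P t \<Longrightarrow> P u \<Longrightarrow> P (t \<oplus>\<^bsub>V \<otimes>\<^sub>V W\<^esub> u)"
  shows "P t"
proof -
  interpret V: module R V by fact
  interpret W: module R W by fact
  let ?F = "free_space (carrier V \<times> carrier W)"
  interpret T: module R "V \<otimes>\<^sub>V W" by (rule tensor_module[OF assms(1,2)])
  note bil = bilinear_pure_tensor[OF assms(1,2), unfolded bilinear_def]
  have smult_pure: "c \<odot>\<^bsub>V \<otimes>\<^sub>V W\<^esub> pure_tensor V W x y = pure_tensor V W (c \<odot>\<^bsub>V\<^esub> x) y"
    if "c \<in> carrier R" "x \<in> carrier V" "y \<in> carrier W" for c x y
    using bil that by (simp add: module_hom_def)
  from t obtain \<phi> where \<phi>: "\<phi> \<in> carrier ?F" and "t = bilinear_span V W +>\<^bsub>?F\<^esub> \<phi>"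
    using assms(1,2) by (auto simp: tensor_carrier)
  moreover have "P (bilinear_span V W +>\<^bsub>?F\<^esub> \<phi>)"
    using \<phi>
  proof (induction \<phi> rule: free_space_induct)
    case zero
    have "\<zero>\<^bsub>V \<otimes>\<^sub>V W\<^esub> = pure_tensor V W \<zero>\<^bsub>V\<^esub> \<zero>\<^bsub>W\<^esub>"
      using smult_pure[of \<zero> "\<zero>\<^bsub>V\<^esub>" "\<zero>\<^bsub>W\<^esub>"] pure_tensor_closed[OF assms(1,2)] by simp
    then show ?case
      using pure[of "\<zero>\<^bsub>V\<^esub>" "\<zero>\<^bsub>W\<^esub>"] tensor_zero_coset[OF assms(1,2)] by (simp del: free_space_simps)
  next
    case (basis c s)
    then obtain x y where s: "s = (x, y)" "x \<in> carrier V" "y \<in> carrier W"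
      by auto
    have "bilinear_span V W +>\<^bsub>?F\<^esub> (c \<odot>\<^bsub>?F\<^esub> free_basis (carrier V \<times> carrier W) s)
        = pure_tensor V W (c \<odot>\<^bsub>V\<^esub> x) y"
      using tensor_smult_coset[OF assms(1,2) basis(1) free_basis_closed[OF basis(2)]]
        smult_pure[OF basis(1) s(2,3)]
      by (simp only: s(1) pure_tensor_def)
    with pure[OF V.smult_closed[OF basis(1) s(2)] s(3)] show ?case
      by (simp only:)
  next
    case (add \<phi> \<psi>)
    from assms(5)[OF _ _ add(3,4)] add(1,2) show ?case
      using tensor_add_coset[OF assms(1,2) add(1,2)] tensor_carrier[OF assms(1,2)]
      by (simp del: free_space_simps)
  qed
  ultimately show ?thesis by simp
qed

text \<open>The kernel of the linear extension is a submodule, so it contains the span as soon as it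
  contains the generators, and for these bilinearity suffices.\<close>

lemma free_lift_kills_relations:
  assumes "module R V" "module R W" "module R U" and \<beta>: "bilinear V W U \<beta>"
    and n: "n \<in> bilinear_span V W"
  shows "free_lift (carrier V \<times> carrier W) U (\<lambda>s. \<beta> (fst s) (snd s)) n = \<zero>\<^bsub>U\<^esub>"
proof -
  let ?S = "carrier V \<times> carrier W" and ?g = "\<lambda>s. \<beta> (fst s) (snd s)"
  let ?F = "free_space ?S"
  interpret V: module R V by fact
  interpret W: module R W by fact
  interpret U: module R U by fact
  interpret F: module R ?F by (rule free_space_module)
  have g: "?g \<in> ?S \<rightarrow> carrier U"
    using bilinear_closed[OF \<beta>] by auto
  interpret E: mod_hom R ?F U "free_lift ?S U ?g"
    by (intro mod_hom.intro mod_hom_axioms.intro free_space_module assms(3) free_lift_hom[OF assms(3) g])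
  have basis: "free_lift ?S U ?g (free_basis ?S (x, y)) = \<beta> x y"
    if "x \<in> carrier V" "y \<in> carrier W" for x y
    using free_lift_basis[OF assms(3) g] that by simp
  \<comment> \<open>Every generator is a difference of two elements on which the extension agrees,
    so this one fact serves all four families.\<close>
  have diff: "free_lift ?S U ?g (\<phi> \<ominus>\<^bsub>?F\<^esub> \<psi>) = \<zero>\<^bsub>U\<^esub>"
    if "\<phi> \<in> carrier ?F" "\<psi> \<in> carrier ?F" "free_lift ?S U ?g \<phi> = free_lift ?S U ?g \<psi>" for \<phi> \<psi>
  proof -
    have eq: "\<phi> \<ominus>\<^bsub>?F\<^esub> \<psi> = \<phi> \<oplus>\<^bsub>?F\<^esub> (\<ominus> \<one> \<odot>\<^bsub>?F\<^esub> \<psi>)"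
      using F.smult_minus_1[OF that(2)] by (simp only: a_minus_def)
    have "free_lift ?S U ?g (\<phi> \<ominus>\<^bsub>?F\<^esub> \<psi>) = free_lift ?S U ?g \<phi> \<oplus>\<^bsub>U\<^esub> \<ominus>\<^bsub>U\<^esub> free_lift ?S U ?g \<psi>"
      unfolding eq using that by (simp add: F.smult_closed U.smult_minus_1 del: free_space_simps)
    then show ?thesis
      using that by (simp add: U.r_neg del: free_space_simps)
  qed
  have "bilinear_relations V W \<subseteq> E.ker"
  proof
    fix r assume r: "r \<in> bilinear_relations V W"
    then have "r \<in> carrier ?F"
      using bilinear_relations_closed[OF assms(1,2)] by blast
    moreover have "free_lift ?S U ?g r = \<zero>\<^bsub>U\<^esub>"
      using r unfolding bilinear_relations_def Let_def
      apply (elim UnE CollectE exE conjE)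
      apply (simp_all only:)
      apply (rule diff; use \<beta> in \<open>simp add: basis bilinear_def module_hom_def del: free_space_simps\<close>)+
      done
    ultimately show "r \<in> E.ker"
      by (simp add: E.ker_def)
  qed
  then have "bilinear_span V W \<subseteq> E.ker"
    unfolding bilinear_span_def by (rule F.span_is_subset[OF _ E.ker_is_submodule])
  with n show ?thesis
    by (auto simp: E.ker_def)
qed

text \<open>The linear extension vanishes on the span, hence is constant on the coset. The image of
  the coset is then a singleton, and \<open>the_elem\<close> returns its element.\<close>

lemma tensor_lift_coset:
  assumes "module R V" "module R W" "module R U" "bilinear V W U \<beta>"
    and \<phi>: "\<phi> \<in> carrier (free_space (carrier V \<times> carrier W))"
  shows "tensor_lift V W U \<beta> (bilinear_span V W +>\<^bsub>free_space (carrier V \<times> carrier W)\<^esub> \<phi>)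
    = free_lift (carrier V \<times> carrier W) U (\<lambda>s. \<beta> (fst s) (snd s)) \<phi>"
proof -
  let ?S = "carrier V \<times> carrier W" and ?g = "\<lambda>s. \<beta> (fst s) (snd s)"
  let ?F = "free_space ?S" and ?N = "bilinear_span V W"
  interpret U: module R U by fact
  interpret N: abelian_subgroup ?N ?F
    by (rule bilinear_span_subgroup[OF assms(1,2)])
  have g: "?g \<in> ?S \<rightarrow> carrier U"
    using bilinear_closed[OF assms(4)] by auto
  note hom = free_lift_hom[OF assms(3) g]
  have "free_lift ?S U ?g \<psi> = free_lift ?S U ?g \<phi>" if "\<psi> \<in> ?N +>\<^bsub>?F\<^esub> \<phi>" for \<psi>
  proof -
    from that obtain n where n: "n \<in> ?N" and \<psi>: "\<psi> = n \<oplus>\<^bsub>?F\<^esub> \<phi>"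
      by (auto simp: a_r_coset_def' simp del: free_space_simps)
    have "free_lift ?S U ?g \<psi> = free_lift ?S U ?g n \<oplus>\<^bsub>U\<^esub> free_lift ?S U ?g \<phi>"
      unfolding \<psi> by (rule module_hom_add[OF hom N.a_Hcarr[OF n] \<phi>])
    then show ?thesis
      using free_lift_kills_relations[OF assms(1-4) n] Pi_mem[OF module_hom_closed[OF hom] \<phi>] by simp
  qed
  moreover have "\<phi> \<in> ?N +>\<^bsub>?F\<^esub> \<phi>"
    by (rule N.a_rcos_self[OF \<phi>])
  ultimately have "free_lift ?S U ?g ` (?N +>\<^bsub>?F\<^esub> \<phi>) = {free_lift ?S U ?g \<phi>}"
    by blast
  then show ?thesis
    unfolding tensor_lift_def free_lift_def[abs_def] by simp
qed

lemma tensor_lift_pure: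
  assumes "module R V" "module R W" "module R U" "bilinear V W U \<beta>"
    and "x \<in> carrier V" "y \<in> carrier W"
  shows "tensor_lift V W U \<beta> (pure_tensor V W x y) = \<beta> x y"
proof -
  have "(\<lambda>s. \<beta> (fst s) (snd s)) \<in> carrier V \<times> carrier W \<rightarrow> carrier U"
    using bilinear_closed[OF assms(4)] by auto
  then show ?thesis
    unfolding pure_tensor_def
    using assms by (simp add: tensor_lift_coset free_lift_basis)
qed

lemma tensor_lift_hom:
  assumes "module R V" "module R W" "module R U" "bilinear V W U \<beta>"
  shows "tensor_lift V W U \<beta> \<in> module_hom R (V \<otimes>\<^sub>V W) U"
proof -
  let ?S = "carrier V \<times> carrier W" and ?g = "\<lambda>s. \<beta> (fst s) (snd s)"
  interpret F: module R "free_space ?S" by (rule free_space_module)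
  have "?g \<in> ?S \<rightarrow> carrier U"
    using bilinear_closed[OF assms(4)] by auto
  note hom = free_lift_hom[OF assms(3) this]
  note simps = tensor_carrier[OF assms(1,2)] tensor_lift_coset[OF assms]
    tensor_add_coset[OF assms(1,2)] tensor_smult_coset[OF assms(1,2)] F.a_closed F.smult_closed
    module_hom_add[OF hom] module_hom_smult[OF hom]
  show ?thesis
    unfolding module_hom_def
    using module_hom_closed[OF hom] by (auto simp: simps simp del: free_space_simps)
qed

section \<open>Structural maps on pure tensors\<close>

lemma id_hom: "id \<in> module_hom R V V"
  by (auto simp: module_hom_def)

lemma module_hom_compose:
  "f \<in> module_hom R U V \<Longrightarrow> g \<in> module_hom R V W \<Longrightarrow> (\<lambda>x. g (f x)) \<in> module_hom R U W"
  by (simp add: module_hom_def Pi_iff)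

lemma module_hom_mem: "f \<in> module_hom R V W \<Longrightarrow> x \<in> carrier V \<Longrightarrow> f x \<in> carrier W"
  by (auto simp: module_hom_def)

lemma bilinear_compose:
  assumes "f \<in> module_hom R V V'" "g \<in> module_hom R W W'" "bilinear V' W' U \<beta>"
  shows "bilinear V W U (\<lambda>x y. \<beta> (f x) (g y))"
  using assms by (simp add: bilinear_def module_hom_def Pi_iff)

lemma bilinear_flip: "bilinear V W U \<beta> \<Longrightarrow> bilinear W V U (\<lambda>y x. \<beta> x y)"
  by (simp add: bilinear_def)

text \<open>The associators nest one lift inside another. Linearity in \<open>t\<close> is the
  universal property; linearity in the parameter \<open>z\<close> needs an induction on
  \<open>t\<close>, with \<open>lin\<close> for pure tensors and linearity of the lift for
  sums.\<close>

lemma bilinear_tensor_lift_left: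
  assumes "module R U" "module R V" "module R W" "module R T"
    and \<beta>: "\<And>z. z \<in> carrier W \<Longrightarrow> bilinear U V T (\<lambda>x y. \<beta> x y z)"
    and lin: "\<And>x y. x \<in> carrier U \<Longrightarrow> y \<in> carrier V \<Longrightarrow> \<beta> x y \<in> module_hom R W T"
  shows "bilinear (U \<otimes>\<^sub>V V) W T (\<lambda>t z. tensor_lift U V T (\<lambda>x y. \<beta> x y z) t)"
proof (rule bilinearI)
  interpret W: module R W by fact
  interpret T: module R T by fact
  interpret UV: module R "U \<otimes>\<^sub>V V" by (rule tensor_module[OF assms(1,2)])
  note hom = tensor_lift_hom[OF assms(1,2,4) \<beta>]
  note pure = tensor_lift_pure[OF assms(1,2,4) \<beta>]
  show "tensor_lift U V T (\<lambda>x y. \<beta> x y z) \<in> module_hom R (U \<otimes>\<^sub>V V) T" if "z \<in> carrier W" for z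
    by (rule hom[OF that])
  fix t assume t: "t \<in> carrier (U \<otimes>\<^sub>V V)"
  let ?f = "\<lambda>z. tensor_lift U V T (\<lambda>x y. \<beta> x y z)"
  have closed: "?f z t \<in> carrier T" if "z \<in> carrier W" "t \<in> carrier (U \<otimes>\<^sub>V V)" for z t
    by (rule module_hom_mem[OF hom[OF that(1)] that(2)])
  have "?f (z \<oplus>\<^bsub>W\<^esub> z') t = ?f z t \<oplus>\<^bsub>T\<^esub> ?f z' t" if z: "z \<in> carrier W" "z' \<in> carrier W" for z z'
    using assms(1,2) t
  proof (induction t rule: tensor_induct)
    case (pure x y)
    then show ?case
      using z module_hom_add[OF lin[OF pure]] by (simp add: tensor_lift_pure assms \<beta>)
  next
    case (add t u)
    then show ?case
      using z by (simp add: module_hom_add[OF hom] closed T.a_ac)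
  qed
  moreover have "?f (c \<odot>\<^bsub>W\<^esub> z) t = c \<odot>\<^bsub>T\<^esub> ?f z t" if z: "c \<in> carrier R" "z \<in> carrier W" for c z
    using assms(1,2) t
  proof (induction t rule: tensor_induct)
    case (pure x y)
    then show ?case
      using z module_hom_smult[OF lin[OF pure]] by (simp add: tensor_lift_pure assms \<beta>)
  next
    case (add t u)
    then show ?case
      using z by (simp add: module_hom_add[OF hom] closed T.smult_r_distr)
  qed
  ultimately show "(\<lambda>z. ?f z t) \<in> module_hom R W T"
    using closed[OF _ t] by (auto simp: module_hom_def)
qed

lemma bilinear_tensor_lift_right:
  assumes "module R U" "module R V" "module R W" "module R T"
    and \<beta>: "\<And>x. x \<in> carrier U \<Longrightarrow> bilinear V W T (\<beta> x)"
    and lin: "\<And>y z. y \<in> carrier V \<Longrightarrow> z \<in> carrier W \<Longrightarrow> (\<lambda>x. \<beta> x y z) \<in> module_hom R U T"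
  shows "bilinear U (V \<otimes>\<^sub>V W) T (\<lambda>x t. tensor_lift V W T (\<lambda>y z. \<beta> x y z) t)"
  by (rule bilinear_flip, rule bilinear_tensor_lift_left) (use assms in auto)

lemma bilinear_tensor_map:
  assumes "module R V'" "module R W'" "f \<in> module_hom R V V'" "g \<in> module_hom R W W'"
  shows "bilinear V W (V' \<otimes>\<^sub>V W') (\<lambda>x y. pure_tensor V' W' (f x) (g y))"
  by (rule bilinear_compose[OF assms(3,4) bilinear_pure_tensor[OF assms(1,2)]])

lemma pure_tensor_smult_left:
  assumes "module R V" "module R W" "c \<in> carrier R" "x \<in> carrier V" "y \<in> carrier W"
  shows "pure_tensor V W (c \<odot>\<^bsub>V\<^esub> x) y = c \<odot>\<^bsub>V \<otimes>\<^sub>V W\<^esub> pure_tensor V W x y"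
  using bilinear_pure_tensor[OF assms(1,2)] assms(3-5) by (simp add: bilinear_def module_hom_def)

lemma pure_tensor_smult_right:
  assumes "module R V" "module R W" "c \<in> carrier R" "x \<in> carrier V" "y \<in> carrier W"
  shows "pure_tensor V W x (c \<odot>\<^bsub>W\<^esub> y) = c \<odot>\<^bsub>V \<otimes>\<^sub>V W\<^esub> pure_tensor V W x y"
  using bilinear_pure_tensor[OF assms(1,2)] assms(3-5) by (simp add: bilinear_def module_hom_def)

section \<open>The monoidal structure: linearity and values on pure tensors\<close>

lemma tensor_map_hom:
  assumes "module R V" "module R W" "module R V'" "module R W'"
    and "f \<in> module_hom R V V'" "g \<in> module_hom R W W'"
  shows "tensor_map V W V' W' f g \<in> module_hom R (V \<otimes>\<^sub>V W) (V' \<otimes>\<^sub>V W')"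
  unfolding tensor_map_def
  by (rule tensor_lift_hom[OF assms(1,2) tensor_module[OF assms(3,4)] bilinear_tensor_map[OF assms(3-6)]])

lemma tensor_map_pure:
  assumes "module R V" "module R W" "module R V'" "module R W'"
    and "f \<in> module_hom R V V'" "g \<in> module_hom R W W'" "x \<in> carrier V" "y \<in> carrier W"
  shows "tensor_map V W V' W' f g (pure_tensor V W x y) = pure_tensor V' W' (f x) (g y)"
  unfolding tensor_map_def
  by (rule tensor_lift_pure[OF assms(1,2) tensor_module[OF assms(3,4)] bilinear_tensor_map[OF assms(3-6)] assms(7,8)])

lemma symmetry_hom:
  assumes "module R V" "module R W"
  shows "symmetry V W \<in> module_hom R (V \<otimes>\<^sub>V W) (W \<otimes>\<^sub>V V)"
  unfolding symmetry_def
  by (rule tensor_lift_hom[OF assms tensor_module[OF assms(2,1)]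
        bilinear_flip[OF bilinear_pure_tensor[OF assms(2,1)]]])

lemma symmetry_pure:
  assumes "module R V" "module R W" "x \<in> carrier V" "y \<in> carrier W"
  shows "symmetry V W (pure_tensor V W x y) = pure_tensor W V y x"
  unfolding symmetry_def
  by (rule tensor_lift_pure[OF assms(1,2) tensor_module[OF assms(2,1)]
        bilinear_flip[OF bilinear_pure_tensor[OF assms(2,1)]] assms(3,4)])

lemma unit_space_simps [simp]:
  "x \<oplus>\<^bsub>unit_space\<^esub> y = x \<oplus> y" "carrier unit_space = carrier R" "c \<odot>\<^bsub>unit_space\<^esub> x = c \<otimes> x"
  by (simp_all add: unit_space_def)

lemma unit_space_module: "module R unit_space"
  by (rule moduleI, rule is_cring, rule abelian_groupI)
    (auto simp: unit_space_def a_ac m_ac l_distr r_distr intro: l_neg)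

lemma bilinear_smult:
  assumes "module R V"
  shows "bilinear unit_space V V (\<lambda>c x. c \<odot>\<^bsub>V\<^esub> x)"
proof -
  interpret V: module R V by fact
  show ?thesis
    by (rule bilinearI)
      (auto simp: module_hom_def unit_space_def V.smult_l_distr V.smult_r_distr V.smult_assoc1[symmetric] m_comm)
qed

lemma left_unitor_hom:
  assumes "module R V"
  shows "left_unitor V \<in> module_hom R (unit_space \<otimes>\<^sub>V V) V"
  unfolding left_unitor_def
  by (rule tensor_lift_hom[OF unit_space_module assms assms bilinear_smult[OF assms]])

lemma left_unitor_pure:
  assumes "module R V" "c \<in> carrier R" "x \<in> carrier V"
  shows "left_unitor V (pure_tensor unit_space V c x) = c \<odot>\<^bsub>V\<^esub> x"
  unfolding left_unitor_def
  by (rule tensor_lift_pure[OF unit_space_module assms(1,1) bilinear_smult[OF assms(1)]])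
    (use assms in \<open>simp_all add: unit_space_def\<close>)

lemma left_unitor_inv_hom:
  assumes "module R V"
  shows "left_unitor_inv V \<in> module_hom R V (unit_space \<otimes>\<^sub>V V)"
  using bilinear_pure_tensor[OF unit_space_module assms]
  by (simp add: bilinear_def left_unitor_inv_def[abs_def] unit_space_def)

lemma bilinear_associator_inner:
  assumes "module R U" "module R V" "module R W" "z \<in> carrier W"
  shows "bilinear U V (U \<otimes>\<^sub>V (V \<otimes>\<^sub>V W)) (\<lambda>x y. pure_tensor U (V \<otimes>\<^sub>V W) x (pure_tensor V W y z))"
proof -
  have "(\<lambda>y. pure_tensor V W y z) \<in> module_hom R V (V \<otimes>\<^sub>V W)"
    using bilinear_pure_tensor[OF assms(2,3)] assms(4) by (simp add: bilinear_def)
  from bilinear_compose[OF id_hom this bilinear_pure_tensor[OF assms(1) tensor_module[OF assms(2,3)]]]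
  show ?thesis by simp
qed

lemma bilinear_associator:
  assumes "module R U" "module R V" "module R W"
  shows "bilinear (U \<otimes>\<^sub>V V) W (U \<otimes>\<^sub>V (V \<otimes>\<^sub>V W))
    (\<lambda>t z. tensor_lift U V (U \<otimes>\<^sub>V (V \<otimes>\<^sub>V W))
        (\<lambda>x y. pure_tensor U (V \<otimes>\<^sub>V W) x (pure_tensor V W y z)) t)"
proof (rule bilinear_tensor_lift_left)
  note VW = tensor_module[OF assms(2,3)]
  fix x y assume x: "x \<in> carrier U" and y: "y \<in> carrier V"
  have "pure_tensor V W y \<in> module_hom R W (V \<otimes>\<^sub>V W)"
    using bilinear_pure_tensor[OF assms(2,3)] y by (simp add: bilinear_def)
  moreover have "pure_tensor U (V \<otimes>\<^sub>V W) x \<in> module_hom R (V \<otimes>\<^sub>V W) (U \<otimes>\<^sub>V (V \<otimes>\<^sub>V W))"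
    using bilinear_pure_tensor[OF assms(1) VW] x by (simp add: bilinear_def)
  ultimately show "(\<lambda>z. pure_tensor U (V \<otimes>\<^sub>V W) x (pure_tensor V W y z))
      \<in> module_hom R W (U \<otimes>\<^sub>V (V \<otimes>\<^sub>V W))"
    by (rule module_hom_compose)
qed (use assms in \<open>auto intro: tensor_module bilinear_associator_inner\<close>)

lemma associator_hom:
  assumes "module R U" "module R V" "module R W"
  shows "associator U V W \<in> module_hom R (U \<otimes>\<^sub>V V \<otimes>\<^sub>V W) (U \<otimes>\<^sub>V (V \<otimes>\<^sub>V W))"
  unfolding associator_def
  by (intro tensor_lift_hom tensor_module assms bilinear_associator)

lemma associator_pure:
  assumes "module R U" "module R V" "module R W"
    and "x \<in> carrier U" "y \<in> carrier V" "z \<in> carrier W"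
  shows "associator U V W (pure_tensor (U \<otimes>\<^sub>V V) W (pure_tensor U V x y) z)
    = pure_tensor U (V \<otimes>\<^sub>V W) x (pure_tensor V W y z)"
  unfolding associator_def
  using assms by (simp add: tensor_lift_pure tensor_module bilinear_associator
      bilinear_associator_inner pure_tensor_closed)

lemma bilinear_associator_inv_inner:
  assumes "module R U" "module R V" "module R W" "x \<in> carrier U"
  shows "bilinear V W (U \<otimes>\<^sub>V V \<otimes>\<^sub>V W) (\<lambda>y z. pure_tensor (U \<otimes>\<^sub>V V) W (pure_tensor U V x y) z)"
proof -
  have "pure_tensor U V x \<in> module_hom R V (U \<otimes>\<^sub>V V)"
    using bilinear_pure_tensor[OF assms(1,2)] assms(4) by (simp add: bilinear_def)
  from bilinear_compose[OF this id_hom bilinear_pure_tensor[OF tensor_module[OF assms(1,2)] assms(3)]]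
  show ?thesis by simp
qed

lemma bilinear_associator_inv:
  assumes "module R U" "module R V" "module R W"
  shows "bilinear U (V \<otimes>\<^sub>V W) (U \<otimes>\<^sub>V V \<otimes>\<^sub>V W)
    (\<lambda>x t. tensor_lift V W (U \<otimes>\<^sub>V V \<otimes>\<^sub>V W)
        (\<lambda>y z. pure_tensor (U \<otimes>\<^sub>V V) W (pure_tensor U V x y) z) t)"
proof (rule bilinear_tensor_lift_right)
  note UV = tensor_module[OF assms(1,2)]
  fix y z assume y: "y \<in> carrier V" and z: "z \<in> carrier W"
  have "(\<lambda>x. pure_tensor U V x y) \<in> module_hom R U (U \<otimes>\<^sub>V V)"
    using bilinear_pure_tensor[OF assms(1,2)] y by (simp add: bilinear_def)
  moreover have "(\<lambda>t. pure_tensor (U \<otimes>\<^sub>V V) W t z) \<in> module_hom R (U \<otimes>\<^sub>V V) (U \<otimes>\<^sub>V V \<otimes>\<^sub>V W)"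
    using bilinear_pure_tensor[OF UV assms(3)] z by (simp add: bilinear_def)
  ultimately show "(\<lambda>x. pure_tensor (U \<otimes>\<^sub>V V) W (pure_tensor U V x y) z)
      \<in> module_hom R U (U \<otimes>\<^sub>V V \<otimes>\<^sub>V W)"
    by (rule module_hom_compose)
qed (use assms in \<open>auto intro: tensor_module bilinear_associator_inv_inner\<close>)

lemma associator_inv_hom:
  assumes "module R U" "module R V" "module R W"
  shows "associator_inv U V W \<in> module_hom R (U \<otimes>\<^sub>V (V \<otimes>\<^sub>V W)) (U \<otimes>\<^sub>V V \<otimes>\<^sub>V W)"
  unfolding associator_inv_def
  by (intro tensor_lift_hom tensor_module assms bilinear_associator_inv)

lemma associator_inv_pure:
  assumes "module R U" "module R V" "module R W"
    and "x \<in> carrier U" "y \<in> carrier V" "z \<in> carrier W"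
  shows "associator_inv U V W (pure_tensor U (V \<otimes>\<^sub>V W) x (pure_tensor V W y z))
    = pure_tensor (U \<otimes>\<^sub>V V) W (pure_tensor U V x y) z"
  unfolding associator_inv_def
  using assms by (simp add: tensor_lift_pure tensor_module bilinear_associator_inv
      bilinear_associator_inv_inner pure_tensor_closed)

text \<open>This composite is an argument of an outer \<open>tensor_map\<close>, whose value on pure
  tensors is known only for linear arguments.\<close>

lemma middle_exchange_inner_hom:
  assumes "module R V" "module R W" "module R X"
  shows "associator W V X \<circ> tensor_map (V \<otimes>\<^sub>V W) X (W \<otimes>\<^sub>V V) X (symmetry V W) id
      \<circ> associator_inv V W X
    \<in> module_hom R (V \<otimes>\<^sub>V (W \<otimes>\<^sub>V X)) (W \<otimes>\<^sub>V (V \<otimes>\<^sub>V X))"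
  unfolding o_def
  by (rule module_hom_compose[OF associator_inv_hom[OF assms]],
      rule module_hom_compose[OF tensor_map_hom associator_hom])
    (intro tensor_module assms symmetry_hom id_hom)+

lemma middle_exchange_hom:
  assumes "module R U" "module R V" "module R W" "module R X"
  shows "middle_exchange U V W X
    \<in> module_hom R ((U \<otimes>\<^sub>V V) \<otimes>\<^sub>V (W \<otimes>\<^sub>V X)) ((U \<otimes>\<^sub>V W) \<otimes>\<^sub>V (V \<otimes>\<^sub>V X))"
  \<comment> \<open>Bracketing to the right and unfolding \<open>comp_def\<close> at two named maps
    only peels off the outer compositions, while the inner composite stays intact as an
    argument.\<close>
  unfolding middle_exchange_def o_assoc[symmetric]
  unfolding comp_def[of "associator_inv U W (V \<otimes>\<^sub>V X)"]
    comp_def[of "tensor_map U (V \<otimes>\<^sub>V (W \<otimes>\<^sub>V X)) U (W \<otimes>\<^sub>V (V \<otimes>\<^sub>V X)) _ _"]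
  by (rule module_hom_compose[OF module_hom_compose[OF associator_hom tensor_map_hom] associator_inv_hom])
    (intro tensor_module assms id_hom middle_exchange_inner_hom[unfolded o_assoc[symmetric]])+

lemma middle_exchange_pure:
  assumes "module R U" "module R V" "module R W" "module R X"
    and "u \<in> carrier U" "v \<in> carrier V" "w \<in> carrier W" "x \<in> carrier X"
  shows "middle_exchange U V W X
      (pure_tensor (U \<otimes>\<^sub>V V) (W \<otimes>\<^sub>V X) (pure_tensor U V u v) (pure_tensor W X w x))
    = pure_tensor (U \<otimes>\<^sub>V W) (V \<otimes>\<^sub>V X) (pure_tensor U W u w) (pure_tensor V X v x)"
  unfolding middle_exchange_def
  using assms
  by (simp add: associator_pure tensor_module pure_tensor_closed associator_inv_pure
      tensor_map_pure[OF _ _ _ _ id_hom middle_exchange_inner_hom]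
      tensor_map_pure[OF _ _ _ _ symmetry_hom id_hom] symmetry_pure)

text \<open>Linear maps out of a module with a cyclic generator are determined by one value, so every
  axiom for one-dimensional spaces reduces to an identity of scalars.\<close>

definition generated_by :: "('a, 'v) module \<Rightarrow> 'v \<Rightarrow> bool" where
  "generated_by V e \<longleftrightarrow> e \<in> carrier V \<and> (\<forall>x\<in>carrier V. \<exists>c\<in>carrier R. x = c \<odot>\<^bsub>V\<^esub> e)"

lemma generated_by_hom_eq:
  assumes "generated_by V e" "f \<in> module_hom R V U" "g \<in> module_hom R V U" "f e = g e"
    and "x \<in> carrier V"
  shows "f x = g x"
proof -
  from assms(1,5) obtain c where "c \<in> carrier R" "e \<in> carrier V" "x = c \<odot>\<^bsub>V\<^esub> e"
    by (auto simp: generated_by_def)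
  with assms(2-4) show ?thesis
    by (simp add: module_hom_smult)
qed

text \<open>Coefficients of the two factors multiply, and a sum of multiples of one tensor is again
  a multiple of it. Iterating covers the threefold tensor products in the associativity
  axiom.\<close>

lemma generated_by_tensor:
  assumes "module R V" "module R W" "generated_by V e" "generated_by W e'"
  shows "generated_by (V \<otimes>\<^sub>V W) (pure_tensor V W e e')"
proof -
  interpret T: module R "V \<otimes>\<^sub>V W" by (rule tensor_module[OF assms(1,2)])
  have e: "e \<in> carrier V" "e' \<in> carrier W"
    using assms by (auto simp: generated_by_def)
  note closed = pure_tensor_closed[OF assms(1,2) e]
  have "\<exists>c\<in>carrier R. t = c \<odot>\<^bsub>V \<otimes>\<^sub>V W\<^esub> pure_tensor V W e e'" if "t \<in> carrier (V \<otimes>\<^sub>V W)" for t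
    using assms(1,2) that
  proof (induction t rule: tensor_induct)
    case (pure x y)
    obtain c where c: "c \<in> carrier R" "x = c \<odot>\<^bsub>V\<^esub> e"
      using assms(3) pure by (auto simp: generated_by_def)
    obtain d where d: "d \<in> carrier R" "y = d \<odot>\<^bsub>W\<^esub> e'"
      using assms(4) pure by (auto simp: generated_by_def)
    have "pure_tensor V W x y = d \<odot>\<^bsub>V \<otimes>\<^sub>V W\<^esub> (c \<odot>\<^bsub>V \<otimes>\<^sub>V W\<^esub> pure_tensor V W e e')"
      using c d e pure by (simp add: pure_tensor_smult_left pure_tensor_smult_right assms(1,2))
    with c d closed show ?case
      by (auto simp: T.smult_assoc1[symmetric])
  next
    case (add t u)
    then show ?case
      using closed by (auto simp: T.smult_l_distr[symmetric])
  qed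
  with closed show ?thesis
    by (simp add: generated_by_def)
qed

lemma generated_by_unit_space: "generated_by unit_space \<one>"
  by (auto simp: generated_by_def unit_space_def intro!: bexI)

section \<open>Bimonoids of lines\<close>

text \<open>The canonical semiring map from the naturals to the field. Its failure to be injective
  is what separates the two bimonoids.\<close>

definition nat_scalar :: "nat \<Rightarrow> 'a" where
  "nat_scalar k = [k] \<cdot> \<one>"

lemma nat_scalar_closed [simp]: "nat_scalar k \<in> carrier R"
  by (simp add: nat_scalar_def)

lemma nat_scalar_0 [simp]: "nat_scalar 0 = \<zero>"
  by (simp add: nat_scalar_def)

lemma nat_scalar_1 [simp]: "nat_scalar (Suc 0) = \<one>"
  by (simp add: nat_scalar_def)

lemma nat_scalar_add: "nat_scalar (k + l) = nat_scalar k \<oplus> nat_scalar l"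
  by (simp add: nat_scalar_def add.nat_pow_mult)

lemma nat_scalar_mult: "nat_scalar (k * l) = nat_scalar k \<otimes> nat_scalar l"
  by (simp add: nat_scalar_def add_pow_ldistr add.nat_pow_pow mult.commute)

text \<open>Axiom (xii) is phrased with iterated addition in the space; this converts it into
  multiplication by a scalar, the form taken by all other coefficients.\<close>

lemma add_pow_eq_nat_scalar:
  assumes "module R V" "x \<in> carrier V"
  shows "[k] \<cdot>\<^bsub>V\<^esub> x = nat_scalar k \<odot>\<^bsub>V\<^esub> x"
proof -
  interpret V: module R V by fact
  show ?thesis
    using assms(2)
    by (induction k) (simp_all add: nat_scalar_add[of _ "Suc 0", simplified] V.smult_l_distr)
qed

lemma finsum_nat_scalar:
  assumes "module R V" "x \<in> carrier V" "finite I"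
  shows "(\<Oplus>\<^bsub>V\<^esub>i\<in>I. nat_scalar (k i) \<odot>\<^bsub>V\<^esub> x) = nat_scalar (\<Sum>i\<in>I. k i) \<odot>\<^bsub>V\<^esub> x"
proof -
  interpret V: module R V by fact
  show ?thesis
    using assms(3,2) by (induction I) (simp_all add: nat_scalar_add V.smult_l_distr)
qed

text \<open>Serves axiom (x): its right-hand side has to be linear in the tensor before it can be
  tested on a generator.\<close>

lemma finsum_module_hom:
  assumes "module R V" "module R U" "finite I" "\<And>i. i \<in> I \<Longrightarrow> f i \<in> module_hom R V U"
  shows "(\<lambda>x. \<Oplus>\<^bsub>U\<^esub>i\<in>I. f i x) \<in> module_hom R V U"
proof -
  interpret V: module R V by fact
  interpret U: module R U by fact
  have closed: "f i x \<in> carrier U" if "i \<in> I" "x \<in> carrier V" for i x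
    by (rule module_hom_mem[OF assms(4)[OF that(1)] that(2)])
  have "(\<Oplus>\<^bsub>U\<^esub>i\<in>I. f i (x \<oplus>\<^bsub>V\<^esub> y)) = (\<Oplus>\<^bsub>U\<^esub>i\<in>I. f i x) \<oplus>\<^bsub>U\<^esub> (\<Oplus>\<^bsub>U\<^esub>i\<in>I. f i y)"
    if xy: "x \<in> carrier V" "y \<in> carrier V" for x y
  proof -
    have "(\<Oplus>\<^bsub>U\<^esub>i\<in>I. f i (x \<oplus>\<^bsub>V\<^esub> y)) = (\<Oplus>\<^bsub>U\<^esub>i\<in>I. f i x \<oplus>\<^bsub>U\<^esub> f i y)"
      by (rule U.finsum_cong') (use xy closed in \<open>auto simp: module_hom_add[OF assms(4)]\<close>)
    also have "\<dots> = (\<Oplus>\<^bsub>U\<^esub>i\<in>I. f i x) \<oplus>\<^bsub>U\<^esub> (\<Oplus>\<^bsub>U\<^esub>i\<in>I. f i y)"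
      by (rule U.finsum_addf) (use xy closed in auto)
    finally show ?thesis .
  qed
  moreover have "(\<Oplus>\<^bsub>U\<^esub>i\<in>I. f i (c \<odot>\<^bsub>V\<^esub> x)) = c \<odot>\<^bsub>U\<^esub> (\<Oplus>\<^bsub>U\<^esub>i\<in>I. f i x)"
    if x: "c \<in> carrier R" "x \<in> carrier V" for c x
  proof -
    have "(\<Oplus>\<^bsub>U\<^esub>i\<in>I. f i (c \<odot>\<^bsub>V\<^esub> x)) = (\<Oplus>\<^bsub>U\<^esub>i\<in>I. c \<odot>\<^bsub>U\<^esub> f i x)"
      by (rule U.finsum_cong') (use x closed in \<open>auto simp: module_hom_smult[OF assms(4)]\<close>)
    also have "\<dots> = c \<odot>\<^bsub>U\<^esub> (\<Oplus>\<^bsub>U\<^esub>i\<in>I. f i x)"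
      by (rule U.finsum_smult_ldistr[symmetric]) (use x closed assms(3) in auto)
    finally show ?thesis .
  qed
  ultimately show ?thesis
    using closed by (auto simp: module_hom_def)
qed

lemma smult_module_hom:
  assumes "module R U" "c \<in> carrier R" "f \<in> module_hom R V U"
  shows "(\<lambda>x. c \<odot>\<^bsub>U\<^esub> f x) \<in> module_hom R V U"
proof -
  interpret U: module R U by fact
  show ?thesis
    using assms(2,3)
    by (auto simp: module_hom_def Pi_iff U.smult_r_distr U.smult_assoc1[symmetric] m_comm)
qed

end

section \<open>Bimonoids with the same line in every degree\<close>

text \<open>A line with a basis vector and its coordinate function. The value
  \<open>\<kappa> e = \<one>\<close> excludes the zero space, on which the final contradiction would
  fail.\<close>

locale based_line = field +
  fixes L :: "('a, 'v) module" and e :: 'v and \<kappa> :: "'v \<Rightarrow> 'a"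
  assumes L: "module R L"
    and e [simp]: "e \<in> carrier L"
    and coordinate_hom: "\<kappa> \<in> module_hom R L unit_space"
    and coordinate_e [simp]: "\<kappa> e = \<one>"
    and coordinate: "x \<in> carrier L \<Longrightarrow> \<kappa> x \<odot>\<^bsub>L\<^esub> e = x"
begin

sublocale L: module R L by (rule L)

text \<open>The map with \<open>x, y \<mapsto> \<kappa> x \<odot> y\<close> is the isomorphism from
  \<open>L \<otimes>\<^sub>V L\<close> to \<open>L\<close> taking the tensor square of
  \<open>e\<close> to \<open>e\<close>, and \<open>x \<mapsto> pure_tensor L L x e\<close> is its
  inverse. The structure constants \<open>m\<close> and \<open>d\<close> are natural numbers, so
  that the axioms become plain arithmetic.\<close>

definition line_bimonoid :: "(nat \<Rightarrow> nat \<Rightarrow> nat) \<Rightarrow> (nat \<Rightarrow> nat \<Rightarrow> nat) \<Rightarrow> ('a, 'v) graded_bimonoid"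
  where "line_bimonoid m d = \<lparr>
    gr = (\<lambda>_. L),
    nabla = (\<lambda>n p. tensor_lift L L L (\<lambda>x y. nat_scalar (m n p) \<odot>\<^bsub>L\<^esub> (\<kappa> x \<odot>\<^bsub>L\<^esub> y))),
    Delta = (\<lambda>n p x. nat_scalar (d n p) \<odot>\<^bsub>L \<otimes>\<^sub>V L\<^esub> pure_tensor L L x e),
    eta = (\<lambda>c. c \<odot>\<^bsub>L\<^esub> e),
    eps = \<kappa>\<rparr>"

lemma gr_line [simp]: "gr (line_bimonoid m d) n = L"
  by (simp add: line_bimonoid_def)

lemma eta_line [simp]: "eta (line_bimonoid m d) c = c \<odot>\<^bsub>L\<^esub> e"
  by (simp add: line_bimonoid_def)

lemma eps_line [simp]: "eps (line_bimonoid m d) = \<kappa>"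
  by (simp add: line_bimonoid_def)

lemma LL: "module R (L \<otimes>\<^sub>V L)"
  by (rule tensor_module[OF L L])

lemma coordinate_closed: "x \<in> carrier L \<Longrightarrow> \<kappa> x \<in> carrier R"
  using module_hom_mem[OF coordinate_hom] by (simp add: unit_space_def)

lemma generated_by_e: "generated_by L e"
  using coordinate coordinate_closed by (metis generated_by_def e)

lemma bilinear_nabla: "bilinear L L L (\<lambda>x y. nat_scalar k \<odot>\<^bsub>L\<^esub> (\<kappa> x \<odot>\<^bsub>L\<^esub> y))"
proof -
  have "bilinear L L L (\<lambda>x y. \<kappa> x \<odot>\<^bsub>L\<^esub> y)"
    using bilinear_compose[OF coordinate_hom id_hom bilinear_smult[OF L]] by simp
  then show ?thesis
    by (auto simp: bilinear_def intro: smult_module_hom[OF L nat_scalar_closed])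
qed

lemma nabla_line_hom: "nabla (line_bimonoid m d) n p \<in> module_hom R (L \<otimes>\<^sub>V L) L"
  by (simp add: line_bimonoid_def tensor_lift_hom L bilinear_nabla)

lemma nabla_line_e: "nabla (line_bimonoid m d) n p (pure_tensor L L e e) = nat_scalar (m n p) \<odot>\<^bsub>L\<^esub> e"
  by (simp add: line_bimonoid_def tensor_lift_pure L bilinear_nabla)

lemma Delta_line_hom: "Delta (line_bimonoid m d) n p \<in> module_hom R L (L \<otimes>\<^sub>V L)"
  using bilinear_pure_tensor[OF L L]
  by (auto simp: line_bimonoid_def bilinear_def intro: smult_module_hom[OF LL nat_scalar_closed])

lemma Delta_line_e:
  "Delta (line_bimonoid m d) n p e = nat_scalar (d n p) \<odot>\<^bsub>L \<otimes>\<^sub>V L\<^esub> pure_tensor L L e e"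
  by (simp add: line_bimonoid_def)

lemma eta_line_hom: "(\<lambda>c. c \<odot>\<^bsub>L\<^esub> e) \<in> module_hom R unit_space L"
  using bilinear_smult[OF L] by (simp add: bilinear_def)

lemma eta_line_hom': "eta (line_bimonoid m d) \<in> module_hom R unit_space L"
  using eta_line_hom by (simp add: line_bimonoid_def)

lemma nat_scalar_smult_smult:
  assumes "module R V" "x \<in> carrier V"
  shows "nat_scalar k \<odot>\<^bsub>V\<^esub> (nat_scalar l \<odot>\<^bsub>V\<^esub> x) = nat_scalar (k * l) \<odot>\<^bsub>V\<^esub> x"
  using module.smult_assoc1[OF assms(1) nat_scalar_closed nat_scalar_closed assms(2)]
  by (simp add: nat_scalar_mult)

text \<open>On generators the monoid axioms see only \<open>m\<close> and the comonoid axioms only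
  \<open>d\<close>. The two meet in \<open>m_d\<close>, which is axiom (xii), and in
  \<open>compat\<close>, which is axiom (x); \<open>m_0\<close> and \<open>d_0\<close> also settle
  axioms (vii) and (viii).\<close>

lemma line_bimonoid_binomial:
  assumes m_0: "\<And>n. m 0 n = 1" and d_0: "\<And>n. d 0 n = 1"
    and m_assoc: "\<And>n p q. m n p * m (n + p) q = m p q * m n (p + q)"
    and d_assoc: "\<And>n p q. d n p * d (n + p) q = d p q * d n (p + q)"
    and m_sym: "\<And>n p. m p n = m n p" and d_sym: "\<And>n p. d p n = d n p"
    and m_d: "\<And>n p. m n p * d n p = (n + p) choose n"
    and compat: "\<And>n p q r. n + p = q + r \<Longrightarrow> m n p * d q r =
      (\<Sum>(a, b, c, k)\<in>{(a, b, c, k). a + b = n \<and> c + k = p \<and> a + c = q \<and> b + k = r}.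
        d a b * d c k * (m a c * m b k))"
  shows "binomial_bimonoid R (line_bimonoid m d)"
proof -
  let ?A = "line_bimonoid m d"
  let ?T = "L \<otimes>\<^sub>V L" and ?ee = "pure_tensor L L e e"
  note mods = L LL unit_space_module
  note homs = nabla_line_hom Delta_line_hom eta_line_hom coordinate_hom id_hom
  have ee: "?ee \<in> carrier ?T"
    by (rule pure_tensor_closed[OF L L e e])
  have gen_T: "generated_by ?T ?ee"
    by (rule generated_by_tensor[OF L L generated_by_e generated_by_e])
  have unit: "nabla ?A 0 n (tensor_map unit_space L L L (eta ?A) id t) = left_unitor L t"
    if "t \<in> carrier (unit_space \<otimes>\<^sub>V L)" for n t
  proof (rule generated_by_hom_eq[OF generated_by_tensor[OF unit_space_module L
          generated_by_unit_space generated_by_e] _ _ _ that])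
    show "(\<lambda>t. nabla ?A 0 n (tensor_map unit_space L L L (eta ?A) id t))
        \<in> module_hom R (unit_space \<otimes>\<^sub>V L) L"
      by (rule module_hom_compose[OF tensor_map_hom nabla_line_hom])
        (rule mods homs eta_line_hom')+
    show "left_unitor L \<in> module_hom R (unit_space \<otimes>\<^sub>V L) L"
      by (rule left_unitor_hom[OF L])
    show "nabla ?A 0 n (tensor_map unit_space L L L (eta ?A) id (pure_tensor unit_space L \<one> e))
        = left_unitor L (pure_tensor unit_space L \<one> e)"
      by (simp add: tensor_map_pure mods eta_line_hom' id_hom nabla_line_e left_unitor_pure m_0)
  qed
  have assoc: "nabla ?A (n + p) q (tensor_map ?T L L L (nabla ?A n p) id t)
      = nabla ?A n (p + q) (tensor_map L ?T L L id (nabla ?A p q) (associator L L L t))"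
    if "t \<in> carrier (?T \<otimes>\<^sub>V L)" for n p q t
  proof (rule generated_by_hom_eq[OF generated_by_tensor[OF LL L gen_T generated_by_e] _ _ _ that])
    show "(\<lambda>t. nabla ?A (n + p) q (tensor_map ?T L L L (nabla ?A n p) id t))
        \<in> module_hom R (?T \<otimes>\<^sub>V L) L"
      by (rule module_hom_compose[OF tensor_map_hom nabla_line_hom]) (rule mods homs)+
    show "(\<lambda>t. nabla ?A n (p + q) (tensor_map L ?T L L id (nabla ?A p q) (associator L L L t)))
        \<in> module_hom R (?T \<otimes>\<^sub>V L) L"
      by (rule module_hom_compose[OF module_hom_compose[OF associator_hom tensor_map_hom] nabla_line_hom])
        (rule mods homs)+
    show "nabla ?A (n + p) q (tensor_map ?T L L L (nabla ?A n p) id (pure_tensor ?T L ?ee e))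
      = nabla ?A n (p + q) (tensor_map L ?T L L id (nabla ?A p q)
          (associator L L L (pure_tensor ?T L ?ee e)))"
      using m_assoc[of n p q]
      by (simp add: associator_pure mods ee tensor_map_pure homs nabla_line_e
          pure_tensor_smult_left pure_tensor_smult_right
          module_hom_smult[OF nabla_line_hom] nat_scalar_smult_smult)
  qed
  have comm: "nabla ?A p n (symmetry L L t) = nabla ?A n p t" if "t \<in> carrier ?T" for n p t
  proof (rule generated_by_hom_eq[OF gen_T _ nabla_line_hom _ that])
    show "(\<lambda>t. nabla ?A p n (symmetry L L t)) \<in> module_hom R ?T L"
      by (rule module_hom_compose[OF symmetry_hom nabla_line_hom]) (rule mods)+
    show "nabla ?A p n (symmetry L L ?ee) = nabla ?A n p ?ee"
      by (simp add: symmetry_pure mods nabla_line_e m_sym[of n p])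
  qed
  \<comment> \<open>The right-hand side is \<open>id x\<close> so that both sides are linear maps
    applied to \<open>x\<close>.\<close>
  have counit: "left_unitor L (tensor_map L L unit_space L \<kappa> id (Delta ?A 0 n x)) = id x"
    if "x \<in> carrier L" for n x
  proof (rule generated_by_hom_eq[OF generated_by_e _ id_hom _ that])
    show "(\<lambda>x. left_unitor L (tensor_map L L unit_space L \<kappa> id (Delta ?A 0 n x))) \<in> module_hom R L L"
      by (rule module_hom_compose[OF module_hom_compose[OF Delta_line_hom tensor_map_hom] left_unitor_hom])
        (rule mods homs)+
    show "left_unitor L (tensor_map L L unit_space L \<kappa> id (Delta ?A 0 n e)) = id e"
      by (simp add: Delta_line_e d_0 module.smult_one[OF LL ee] tensor_map_pure mods homs left_unitor_pure)
  qed
  have coassoc: "associator L L L (tensor_map L L ?T L (Delta ?A n p) id (Delta ?A (n + p) q x))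
      = tensor_map L L L ?T id (Delta ?A p q) (Delta ?A n (p + q) x)"
    if "x \<in> carrier L" for n p q x
  proof (rule generated_by_hom_eq[OF generated_by_e _ _ _ that])
    \<comment> \<open>On the generator each \<open>Delta\<close> produces a scalar, which has to be
      moved out through the maps applied after it; hence their linearity is recorded
      separately.\<close>
    have tm1: "tensor_map L L ?T L (Delta ?A n p) id \<in> module_hom R ?T (?T \<otimes>\<^sub>V L)"
      by (rule tensor_map_hom) (rule mods homs)+
    have tm2: "tensor_map L L L ?T id (Delta ?A p q) \<in> module_hom R ?T (L \<otimes>\<^sub>V ?T)"
      by (rule tensor_map_hom) (rule mods homs)+
    have assoc_hom: "associator L L L \<in> module_hom R (?T \<otimes>\<^sub>V L) (L \<otimes>\<^sub>V ?T)"
      by (rule associator_hom) (rule mods)+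
    show "(\<lambda>x. associator L L L (tensor_map L L ?T L (Delta ?A n p) id (Delta ?A (n + p) q x)))
        \<in> module_hom R L (L \<otimes>\<^sub>V ?T)"
      by (rule module_hom_compose[OF module_hom_compose[OF Delta_line_hom tm1] assoc_hom])
    show "(\<lambda>x. tensor_map L L L ?T id (Delta ?A p q) (Delta ?A n (p + q) x))
        \<in> module_hom R L (L \<otimes>\<^sub>V ?T)"
      by (rule module_hom_compose[OF Delta_line_hom tm2])
    show "associator L L L (tensor_map L L ?T L (Delta ?A n p) id (Delta ?A (n + p) q e))
      = tensor_map L L L ?T id (Delta ?A p q) (Delta ?A n (p + q) e)"
      using d_assoc[of n p q]
      by (simp add: Delta_line_e module_hom_smult[OF tm1] module_hom_smult[OF tm2]
          module_hom_smult[OF assoc_hom] ee tensor_map_pure mods homs tensor_module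
          pure_tensor_closed pure_tensor_smult_left pure_tensor_smult_right
          associator_pure nat_scalar_smult_smult mult.commute)
  qed
  have cocomm: "symmetry L L (Delta ?A n p x) = Delta ?A p n x" if "x \<in> carrier L" for n p x
  proof (rule generated_by_hom_eq[OF generated_by_e _ Delta_line_hom _ that])
    note sym = symmetry_hom[OF L L]
    show "(\<lambda>x. symmetry L L (Delta ?A n p x)) \<in> module_hom R L ?T"
      by (rule module_hom_compose[OF Delta_line_hom sym])
    show "symmetry L L (Delta ?A n p e) = Delta ?A p n e"
      by (simp add: Delta_line_e module_hom_smult[OF sym] ee symmetry_pure mods d_sym[of n p])
  qed
  have nabla_eps: "\<kappa> (nabla ?A 0 0 t)
      = left_unitor unit_space (tensor_map L L unit_space unit_space \<kappa> \<kappa> t)"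
    if "t \<in> carrier ?T" for t
  proof (rule generated_by_hom_eq[OF gen_T _ _ _ that])
    show "(\<lambda>t. \<kappa> (nabla ?A 0 0 t)) \<in> module_hom R ?T unit_space"
      by (rule module_hom_compose[OF nabla_line_hom coordinate_hom])
    show "(\<lambda>t. left_unitor unit_space (tensor_map L L unit_space unit_space \<kappa> \<kappa> t))
        \<in> module_hom R ?T unit_space"
      by (rule module_hom_compose[OF tensor_map_hom left_unitor_hom]) (rule mods homs)+
    show "\<kappa> (nabla ?A 0 0 ?ee)
        = left_unitor unit_space (tensor_map L L unit_space unit_space \<kappa> \<kappa> ?ee)"
      by (simp add: nabla_line_e m_0 tensor_map_pure mods homs left_unitor_pure)
  qed
  have eta_Delta: "Delta ?A 0 0 (eta ?A c)
      = tensor_map unit_space unit_space L L (eta ?A) (eta ?A) (left_unitor_inv unit_space c)"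
    if "c \<in> carrier unit_space" for c
  proof (rule generated_by_hom_eq[OF generated_by_unit_space _ _ _ that])
    show "(\<lambda>c. Delta ?A 0 0 (eta ?A c)) \<in> module_hom R unit_space ?T"
      by (rule module_hom_compose[OF eta_line_hom' Delta_line_hom])
    show "(\<lambda>c. tensor_map unit_space unit_space L L (eta ?A) (eta ?A) (left_unitor_inv unit_space c))
        \<in> module_hom R unit_space ?T"
      by (rule module_hom_compose[OF left_unitor_inv_hom tensor_map_hom]) (rule mods eta_line_hom')+
    show "Delta ?A 0 0 (eta ?A \<one>)
        = tensor_map unit_space unit_space L L (eta ?A) (eta ?A) (left_unitor_inv unit_space \<one>)"
      by (simp add: left_unitor_inv_def tensor_map_pure mods eta_line_hom' Delta_line_e d_0
          module.smult_one[OF LL ee])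
  qed
  have nabla_Delta: "Delta ?A q r (nabla ?A n p t) = finsum ?T (\<lambda>(a, b, c, k).
        tensor_map ?T ?T L L (nabla ?A a c) (nabla ?A b k)
          (middle_exchange L L L L (tensor_map L L ?T ?T (Delta ?A a b) (Delta ?A c k) t)))
        {(a, b, c, k). a + b = n \<and> c + k = p \<and> a + c = q \<and> b + k = r}"
    if eq: "n + p = q + r" and t: "t \<in> carrier ?T" for n p q r t
  proof -
    let ?I = "{(a, b, c, k). a + b = n \<and> c + k = p \<and> a + c = q \<and> b + k = r}"
    \<comment> \<open>Taking the index first and the tensor second exhibits each summand as a linear
      map, as \<open>finsum_module_hom\<close> requires.\<close>
    define f where "f = (\<lambda>(a, b, c, k) t. tensor_map ?T ?T L L (nabla ?A a c) (nabla ?A b k)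
        (middle_exchange L L L L (tensor_map L L ?T ?T (Delta ?A a b) (Delta ?A c k) t)))"
    have fin: "finite ?I"
      by (rule finite_subset[of _ "{..n} \<times> {..n} \<times> {..p} \<times> {..p}"]) auto
    have TT: "module R (?T \<otimes>\<^sub>V ?T)"
      by (rule tensor_module[OF LL LL])
    have f1: "tensor_map L L ?T ?T (Delta ?A a b) (Delta ?A c k) \<in> module_hom R ?T (?T \<otimes>\<^sub>V ?T)" for a b c k
      by (rule tensor_map_hom) (rule mods homs)+
    have f2: "middle_exchange L L L L \<in> module_hom R (?T \<otimes>\<^sub>V ?T) (?T \<otimes>\<^sub>V ?T)"
      by (rule middle_exchange_hom) (rule mods)+
    have f3: "tensor_map ?T ?T L L (nabla ?A a c) (nabla ?A b k) \<in> module_hom R (?T \<otimes>\<^sub>V ?T) ?T" for a b c k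
      by (rule tensor_map_hom) (rule mods homs)+
    have f_hom: "f i \<in> module_hom R ?T ?T" for i
      unfolding f_def
      by (cases i) (simp add: module_hom_compose[OF module_hom_compose[OF f1 f2] f3])
    \<comment> \<open>\<open>middle_exchange\<close> fixes the fourfold tensor of \<open>e\<close>,
      so only the four structure constants survive, as a product.\<close>
    have f_ee: "f (a, b, c, k) ?ee = nat_scalar (d a b * d c k * (m a c * m b k)) \<odot>\<^bsub>?T\<^esub> ?ee" for a b c k
      by (simp add: f_def tensor_map_pure mods homs Delta_line_e nabla_line_e pure_tensor_closed
          ee pure_tensor_smult_left pure_tensor_smult_right TT nat_scalar_smult_smult
          module_hom_smult[OF f2] module_hom_smult[OF f3] middle_exchange_pure
          module.smult_closed[OF LL] module.smult_closed[OF TT] ac_simps)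
    have "Delta ?A q r (nabla ?A n p t) = (\<Oplus>\<^bsub>?T\<^esub>i\<in>?I. f i t)"
    proof (rule generated_by_hom_eq[OF gen_T _ _ _ t])
      show "(\<lambda>t. Delta ?A q r (nabla ?A n p t)) \<in> module_hom R ?T ?T"
        by (rule module_hom_compose[OF nabla_line_hom Delta_line_hom])
      show "(\<lambda>t. \<Oplus>\<^bsub>?T\<^esub>i\<in>?I. f i t) \<in> module_hom R ?T ?T"
        by (rule finsum_module_hom[OF LL LL fin f_hom])
      have "(\<Oplus>\<^bsub>?T\<^esub>i\<in>?I. f i ?ee) = (\<Oplus>\<^bsub>?T\<^esub>i\<in>?I.
          nat_scalar ((\<lambda>(a, b, c, k). d a b * d c k * (m a c * m b k)) i) \<odot>\<^bsub>?T\<^esub> ?ee)"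
        by (rule abelian_monoid.finsum_cong')
          (use LL ee in \<open>auto simp: f_ee module_def abelian_group_def intro!: module.smult_closed[OF LL]\<close>)
      \<comment> \<open>The coefficients are summed as natural numbers before passing to the field,
        so \<open>compat\<close> is needed only over the naturals.\<close>
      also have "\<dots> = nat_scalar (m n p * d q r) \<odot>\<^bsub>?T\<^esub> ?ee"
        unfolding compat[OF eq] by (rule finsum_nat_scalar[OF LL ee fin])
      also have "\<dots> = Delta ?A q r (nabla ?A n p ?ee)"
        by (simp add: nabla_line_e Delta_line_e module_hom_smult[OF Delta_line_hom]
            nat_scalar_smult_smult LL ee)
      finally show "Delta ?A q r (nabla ?A n p ?ee) = (\<Oplus>\<^bsub>?T\<^esub>i\<in>?I. f i ?ee)"
        by (rule sym)
    qed
    moreover have "(\<lambda>i. f i t) = (\<lambda>(a, b, c, k). tensor_map ?T ?T L L (nabla ?A a c) (nabla ?A b k)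
        (middle_exchange L L L L (tensor_map L L ?T ?T (Delta ?A a b) (Delta ?A c k) t)))"
      by (auto simp: f_def)
    ultimately show ?thesis
      by (simp only:)
  qed
  have Delta_nabla: "nabla ?A n p (Delta ?A n p x) = [((n + p) choose n)] \<cdot>\<^bsub>L\<^esub> x"
    if x: "x \<in> carrier L" for n p x
    unfolding add_pow_eq_nat_scalar[OF L x]
  proof (rule generated_by_hom_eq[OF generated_by_e _ _ _ x])
    show "(\<lambda>x. nabla ?A n p (Delta ?A n p x)) \<in> module_hom R L L"
      by (rule module_hom_compose[OF Delta_line_hom nabla_line_hom])
    show "(\<lambda>x. nat_scalar ((n + p) choose n) \<odot>\<^bsub>L\<^esub> x) \<in> module_hom R L L"
      using smult_module_hom[OF L nat_scalar_closed id_hom] by simp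
    show "nabla ?A n p (Delta ?A n p e) = nat_scalar ((n + p) choose n) \<odot>\<^bsub>L\<^esub> e"
      by (simp add: Delta_line_e module_hom_smult[OF nabla_line_hom] ee nabla_line_e
          nat_scalar_smult_smult L m_d[symmetric] mult.commute)
  qed
  show ?thesis
    by (intro binomial_bimonoid.intro binomial_bimonoid_axioms.intro)
      (use unit assoc comm counit coassoc cocomm nabla_eps eta_Delta nabla_Delta Delta_nabla
        in \<open>simp_all add: field_axioms vectorspace_def L nabla_line_hom Delta_line_hom
          eta_line_hom' coordinate_hom coordinate_closed coordinate module_hom_smult[OF coordinate_hom]\<close>)
qed

lemma nabla_line_zero:
  assumes "nat_scalar (m n p) = \<zero>" "t \<in> carrier (L \<otimes>\<^sub>V L)"
  shows "nabla (line_bimonoid m d) n p t = \<zero>\<^bsub>L\<^esub>"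
proof (rule generated_by_hom_eq[OF generated_by_tensor[OF L L generated_by_e generated_by_e]
      nabla_line_hom _ _ assms(2)])
  show "(\<lambda>_. \<zero>\<^bsub>L\<^esub>) \<in> module_hom R (L \<otimes>\<^sub>V L) L"
    by (simp add: module_hom_def)
  show "nabla (line_bimonoid m d) n p (pure_tensor L L e e) = \<zero>\<^bsub>L\<^esub>"
    using assms(1) by (simp add: nabla_line_e)
qed

text \<open>In the source the product of \<open>e\<close> with itself in degrees \<open>n\<close>
  and \<open>p\<close> is \<open>e\<close>; in the target every such product is zero. So a morphism
  kills \<open>e\<close> in degree \<open>n + p\<close> and has no left inverse.\<close>

lemma line_bimonoid_not_isomorphic:
  assumes m: "nat_scalar (m n p) = \<one>" and m': "nat_scalar (m' n p) = \<zero>"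
  shows "\<not> binomial_bimonoid_isomorphic (line_bimonoid m d) (line_bimonoid m' d')"
proof
  assume "binomial_bimonoid_isomorphic (line_bimonoid m d) (line_bimonoid m' d')"
  then obtain f g where f: "binomial_bimonoid_hom (line_bimonoid m d) (line_bimonoid m' d') f"
    and g: "binomial_bimonoid_hom (line_bimonoid m' d') (line_bimonoid m d) g"
    and gf: "\<And>n x. x \<in> carrier L \<Longrightarrow> g n (f n x) = x"
    unfolding binomial_bimonoid_isomorphic_def gr_line by blast
  have f_hom: "f k \<in> module_hom R L L" and g_hom: "g k \<in> module_hom R L L" for k
    using f g unfolding binomial_bimonoid_hom_def gr_line by blast+
  have ee: "pure_tensor L L e e \<in> carrier (L \<otimes>\<^sub>V L)"
    by (rule pure_tensor_closed[OF L L e e])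
  then have "f (n + p) (nabla (line_bimonoid m d) n p (pure_tensor L L e e))
    = nabla (line_bimonoid m' d') n p (tensor_map L L L L (f n) (f p) (pure_tensor L L e e))"
    using f unfolding binomial_bimonoid_hom_def gr_line by simp
  also have "\<dots> = \<zero>\<^bsub>L\<^esub>"
    by (rule nabla_line_zero) (rule m', rule module_hom_mem[OF tensor_map_hom[OF L L L L f_hom f_hom] ee])
  finally have "f (n + p) e = \<zero>\<^bsub>L\<^esub>"
    by (simp add: nabla_line_e m)
  then have "g (n + p) \<zero>\<^bsub>L\<^esub> = e"
    using gf[OF e, of "n + p"] by simp
  moreover have "g (n + p) \<zero>\<^bsub>L\<^esub> = \<zero>\<^bsub>L\<^esub>"
    using module_hom_smult[OF g_hom, of \<zero> e "n + p"] module_hom_mem[OF g_hom e] by simp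
  \<comment> \<open>At this point \<open>e\<close> is the zero vector, written as a zero multiple so
    that linearity of \<open>\<kappa>\<close> contradicts
    \<open>\<kappa> e = \<one>\<close>.\<close>
  ultimately have "\<kappa> (\<zero> \<odot>\<^bsub>L\<^esub> e) = \<one>"
    by simp
  then show False
    using module_hom_smult[OF coordinate_hom zero_closed e] by simp
qed

end

section \<open>Binomial identities behind the axioms\<close>

text \<open>The indices are the two-by-two tables with rows \<open>(a, b)\<close> and
  \<open>(c, k)\<close>, row sums \<open>n\<close>, \<open>p\<close> and column sums
  \<open>q\<close>, \<open>r\<close>. Such a table is determined by its corner \<open>a\<close>,
  which turns the sum into Vandermonde's.\<close>

lemma sum_binomials_margins:
  fixes n p q r :: nat
  assumes "n + p = q + r"
  shows "(\<Sum>(a, b, c, k)\<in>{(a, b, c, k). a + b = n \<and> c + k = p \<and> a + c = q \<and> b + k = r}.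
      (a + b choose a) * (c + k choose c)) = (n + p) choose q"
proof -
  have "(\<Sum>(a, b, c, k)\<in>{(a, b, c, k). a + b = n \<and> c + k = p \<and> a + c = q \<and> b + k = r}.
      (a + b choose a) * (c + k choose c))
    = (\<Sum>a\<in>{a. a \<le> q \<and> a \<le> n \<and> q - a \<le> p}. (n choose a) * (p choose (q - a)))"
    by (rule sum.reindex_bij_witness[where i = "\<lambda>a. (a, n - a, q - a, p - (q - a))" and j = fst])
      (use assms in auto)
  \<comment> \<open>The added terms have \<open>a > n\<close> or \<open>q - a > p\<close>, so one of
    their binomials is zero.\<close>
  also have "\<dots> = (\<Sum>a\<le>q. (n choose a) * (p choose (q - a)))"
    by (rule sum.mono_neutral_left) auto
  also have "\<dots> = (n + p) choose q"
    by (rule vandermonde)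
  finally show ?thesis .
qed

text \<open>Transposing the table swaps \<open>b\<close> with \<open>c\<close> and exchanges row
  sums with column sums.\<close>

lemma sum_binomials_margins_transposed:
  fixes n p q r :: nat
  assumes "n + p = q + r"
  shows "(\<Sum>(a, b, c, k)\<in>{(a, b, c, k). a + b = n \<and> c + k = p \<and> a + c = q \<and> b + k = r}.
      (a + c choose a) * (b + k choose b)) = (n + p) choose n"
proof -
  have "(\<Sum>(a, b, c, k)\<in>{(a, b, c, k). a + b = n \<and> c + k = p \<and> a + c = q \<and> b + k = r}.
      (a + c choose a) * (b + k choose b))
    = (\<Sum>(a, b, c, k)\<in>{(a, b, c, k). a + b = q \<and> c + k = r \<and> a + c = n \<and> b + k = p}.
      (a + b choose a) * (c + k choose c))"
    by (rule sum.reindex_bij_witness[where i = "\<lambda>(a, b, c, k). (a, c, b, k)"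
          and j = "\<lambda>(a, b, c, k). (a, c, b, k)"]) auto
  then show ?thesis
    using sum_binomials_margins[OF assms[symmetric]] assms by simp
qed

text \<open>Both sides are the trinomial coefficient of \<open>n\<close>, \<open>p\<close>,
  \<open>q\<close>. This is associativity for divided powers and coassociativity for symmetric
  powers.\<close>

lemma binomial_cocycle:
  fixes n p q :: nat
  shows "(n + p choose n) * (n + p + q choose (n + p)) = (p + q choose p) * (n + (p + q) choose n)"
  using choose_mult[of n "n + p" "n + p + q"] by (simp add: ac_simps)

lemma binomial_flip: "(p + n choose p) = (n + p choose n)" for n p :: nat
  using binomial_symmetric[of p "p + n"] by (simp add: add.commute)

section \<open>Symmetric and divided powers of a line\<close>

context based_line
begin

text \<open>In degree \<open>n\<close> these are the symmetric power and the divided power of a line: \<open>e\<close> stands for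
  the monomial \<open>x ^ n\<close> in the former and for its divided power in the latter.\<close>

lemma symmetric_powers_binomial:
  "binomial_bimonoid R (line_bimonoid (\<lambda>_ _. 1) (\<lambda>n p. n + p choose n))"
proof (rule line_bimonoid_binomial)
  fix n p q r :: nat
  assume "n + p = q + r"
  \<comment> \<open>The degree equation is passed on once more because the goal has
    \<open>q + r choose q\<close>, while the identity yields \<open>n + p choose q\<close>.\<close>
  from sum_binomials_margins[OF this] this
  show "1 * (q + r choose q) = (\<Sum>(a, b, c, k)\<in>{(a, b, c, k).
      a + b = n \<and> c + k = p \<and> a + c = q \<and> b + k = r}.
      (a + b choose a) * (c + k choose c) * (1 * 1))"
    by simp
qed (simp, simp, simp, rule binomial_cocycle, simp, rule binomial_flip, simp)

lemma divided_powers_binomial: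
  "binomial_bimonoid R (line_bimonoid (\<lambda>n p. n + p choose n) (\<lambda>_ _. 1))"
proof (rule line_bimonoid_binomial)
  fix n p q r :: nat
  assume "n + p = q + r"
  \<comment> \<open>The binomials now come from the products, hence from the columns of the
    table.\<close>
  from sum_binomials_margins_transposed[OF this]
  show "(n + p choose n) * 1 = (\<Sum>(a, b, c, k)\<in>{(a, b, c, k).
      a + b = n \<and> c + k = p \<and> a + c = q \<and> b + k = r}.
      1 * 1 * ((a + c choose a) * (b + k choose b)))"
    by simp
qed (simp, simp, rule binomial_cocycle, simp, rule binomial_flip, simp, simp)

end

text \<open>Functions on one point are a copy of the field; with \<open>s\<close> a natural number
  their type is the one prescribed for both bimonoids.\<close>

lemma (in field) func_space_singleton_line:
  "based_line R (func_space {s}) (\<lambda>_\<in>{s}. \<one>) (\<lambda>x. x s)"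
proof (intro based_line.intro based_line_axioms.intro)
  show "module R (func_space {s})"
    by (rule func_space_is_module)
  fix x assume "x \<in> carrier (func_space {s})"
  then show "x s \<odot>\<^bsub>func_space {s}\<^esub> (\<lambda>_\<in>{s}. \<one>) = x"
    by (auto simp: func_space_def fun_eq_iff PiE_def extensional_def)
qed (auto simp: func_space_def module_hom_def field_axioms)

theorem proposition61:
  fixes K :: "('a, 'm) ring_scheme"
  assumes "field K" and "0 < ring_characteristic K"
  shows "\<exists>(A :: ('a, nat \<Rightarrow> 'a) graded_bimonoid) (B :: ('a, nat \<Rightarrow> 'a) graded_bimonoid).
    binomial_bimonoid K A \<and> binomial_bimonoid K B \<and>
    \<not> field.binomial_bimonoid_isomorphic K A B \<and>
    field.graded_isomorphic K (gr A) (gr B)"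
proof -
  interpret field K by fact
  interpret based_line K "func_space {0::nat}" "\<lambda>_\<in>{0}. \<one>\<^bsub>K\<^esub>" "\<lambda>x. x 0"
    by (rule func_space_singleton_line)
  let ?A = "line_bimonoid (\<lambda>_ _. 1) (\<lambda>n p. n + p choose n)"
  let ?B = "line_bimonoid (\<lambda>n p. n + p choose n) (\<lambda>_ _. 1)"
  \<comment> \<open>\<open>ring_characteristic\<close> is zero when no positive multiple of one
    vanishes, so its positivity provides \<open>N\<close>.\<close>
  obtain N :: nat where N: "0 < N" "nat_scalar N = \<zero>\<^bsub>K\<^esub>"
    using assms(2) by (auto simp: ring_characteristic_def nat_scalar_def split: if_splits)
  \<comment> \<open>With \<open>n = 1\<close> and \<open>p = N - 1\<close> the product scalar of
    \<open>?B\<close> is \<open>N choose 1\<close>, that is \<open>N\<close>; the subtraction is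
    exact as \<open>N\<close> is positive.\<close>
  have "\<not> binomial_bimonoid_isomorphic ?A ?B"
    by (rule line_bimonoid_not_isomorphic[where n = 1 and p = "N - 1"]) (use N in simp_all)
  moreover have "graded_isomorphic (gr ?A) (gr ?B)"
    unfolding graded_isomorphic_def using id_hom by (intro exI[of _ "\<lambda>_. id"]) simp
  ultimately show ?thesis
    using symmetric_powers_binomial divided_powers_binomial by blast
qed

end
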